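(* Let $\beta>1$ satisfy $\beta^{N+1}-\beta^N-1=0$ for some positive integer $N$. Then for $\alpha\in(0,1/(N+1))$ we have $$\dim_H(\Lambda_\alpha)=\frac1{\log\beta}\left((1-N\alpha)\log\frac{1-N\alpha}{1-(N+1)\alpha}-\alpha\log\frac{\alpha}{1-(N+1)\alpha}\right).$$
   Context: For $1<\beta\le2$, $\tau_\beta(x)=\beta x-[\beta x]$ on $[0,1]$ and $g_n(x)=[\beta\tau_\beta^{n-1}(x)]$ are the greedy digits of $x$. $\{0,1\}^{\mathbb N}$ carries the product topology, the lexicographic order $\preceq$ and the left shift $\sigma$. $\underline1:=\lim_{y\nearrow1}(g_n(y))_{n\ge1}$ is the quasi-greedy expansion of $1$. The beta-shift is $X_\beta=\{\underline x\in\{0,1\}^{\mathbb N}:\sigma^n(\underline x)\preceq\underline1\ \forall n\ge0\}$. For $\alpha\in[0,1]$, $\Lambda_\alpha=\{(x_i)_{i\ge1}\in X_\beta:\lim_{n\to\infty}\frac1n\sum_{i=1}^nx_i=\alpha\}$. Hausdorff dimension is with respect to the metric $d_\beta(\underline x,\underline y)=\beta^{-\min\{k\ge0:x_{k+1}\ne y_{k+1}\}}$ for $\underline x\ne\underline y$. *)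

theory Defs
  imports "HOL-Analysis.Analysis" "HOL-Library.Fun_Lexorder"
begin

section \<open>Hausdorff dimension of a subset \<open>E\<close> of a metric space \<open>(M, d)\<close>\<close>

definition diam_wrt :: "('a \<Rightarrow> 'a \<Rightarrow> real) \<Rightarrow> 'a set \<Rightarrow> real" where
  "diam_wrt d U = (if U = {} then 0 else SUP (x, y)\<in>U \<times> U. d x y)"

text \<open>The contribution \<open>(diam U)\<^sup>s\<close> of a covering set, with the usual conventions that the empty set
  contributes \<open>0\<close> and that \<open>0\<^sup>0 = 1\<close> for nonempty sets (whereas \<open>0 powr 0 = 0\<close> in HOL).\<close>

definition diam_pow :: "('a \<Rightarrow> 'a \<Rightarrow> real) \<Rightarrow> real \<Rightarrow> 'a set \<Rightarrow> ennreal" where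
  "diam_pow d s U =
     (if U = {} then 0 else if s = 0 then 1 else ennreal (diam_wrt d U powr s))"

text \<open>Finite covers are included, since some of the \<open>U i\<close> may be empty. The bound on all distances
  says that the diameter is at most \<open>\<delta>\<close>; it also guarantees that the supremum in
  \<open>diam_wrt\<close> is taken over a bounded set.\<close>

definition delta_covers :: "'a set \<Rightarrow> ('a \<Rightarrow> 'a \<Rightarrow> real) \<Rightarrow> real \<Rightarrow> 'a set \<Rightarrow> (nat \<Rightarrow> 'a set) set" where
  "delta_covers M d \<delta> E =
     {U. (\<forall>i. U i \<subseteq> M) \<and> (\<forall>i. \<forall>x\<in>U i. \<forall>y\<in>U i. d x y \<le> \<delta>) \<and> E \<subseteq> (\<Union>i. U i)}"

definition hausdorff_premeasure ::
  "'a set \<Rightarrow> ('a \<Rightarrow> 'a \<Rightarrow> real) \<Rightarrow> real \<Rightarrow> real \<Rightarrow> 'a set \<Rightarrow> ennreal" where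
  "hausdorff_premeasure M d s \<delta> E = (INF U\<in>delta_covers M d \<delta> E. \<Sum>i. diam_pow d s (U i))"

definition hausdorff_measure ::
  "'a set \<Rightarrow> ('a \<Rightarrow> 'a \<Rightarrow> real) \<Rightarrow> real \<Rightarrow> 'a set \<Rightarrow> ennreal" where
  "hausdorff_measure M d s E = (SUP \<delta>\<in>{0<..}. hausdorff_premeasure M d s \<delta> E)"

text \<open>Extended-real valued: the dimension is \<open>\<infinity>\<close> if no \<open>s\<close> gives measure zero.\<close>

definition hausdorff_dim :: "'a set \<Rightarrow> ('a \<Rightarrow> 'a \<Rightarrow> real) \<Rightarrow> 'a set \<Rightarrow> ereal" where
  "hausdorff_dim M d E = Inf (ereal ` {s. 0 \<le> s \<and> hausdorff_measure M d s E = 0})"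

section \<open>Binary sequences and beta-expansions\<close>

text \<open>All sequences are indexed from \<open>0\<close>: the entry \<open>x i\<close> is the entry \<open>x\<^sub>i\<^sub>+\<^sub>1\<close> of a sequence
  \<open>(x\<^sub>i)\<^bsub>i \<ge> 1\<^esub>\<close>.\<close>

definition binary_seqs :: "(nat \<Rightarrow> nat) set" where
  "binary_seqs = {x. \<forall>i. x i \<in> {0, 1}}"

definition shift_seq :: "(nat \<Rightarrow> 'a) \<Rightarrow> nat \<Rightarrow> 'a" where
  "shift_seq x = (\<lambda>i. x (Suc i))"

definition lex_le :: "(nat \<Rightarrow> nat) \<Rightarrow> (nat \<Rightarrow> nat) \<Rightarrow> bool" where
  "lex_le x y \<longleftrightarrow> x = y \<or> less_fun x y"

definition dist_beta :: "real \<Rightarrow> (nat \<Rightarrow> nat) \<Rightarrow> (nat \<Rightarrow> nat) \<Rightarrow> real" where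
  "dist_beta \<beta> x y = (if x = y then 0 else \<beta> powr (- real (LEAST k. x k \<noteq> y k)))"

definition beta_map :: "real \<Rightarrow> real \<Rightarrow> real" where
  "beta_map \<beta> x = \<beta> * x - real_of_int \<lfloor>\<beta> * x\<rfloor>"

definition greedy_digits :: "real \<Rightarrow> real \<Rightarrow> nat \<Rightarrow> nat" where
  "greedy_digits \<beta> x n = nat \<lfloor>\<beta> * (beta_map \<beta> ^^ n) x\<rfloor>"

text \<open>The limit is taken in \<open>nat \<Rightarrow> nat\<close> with the product topology of the library, i.e. the
  product of discrete topologies. (\<open>Lim\<close> is not available at this type, as the library does
  not declare it an instance of \<open>t2_space\<close>.)\<close>

definition quasi_greedy_one :: "real \<Rightarrow> nat \<Rightarrow> nat" where
  "quasi_greedy_one \<beta> = (THE l. (greedy_digits \<beta> \<longlongrightarrow> l) (at_left 1))"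

lemma beta_map_at_left:
  assumes "\<beta> > 1"
  shows "filterlim (beta_map \<beta>) (at_left (\<beta> * c - real_of_int (\<lceil>\<beta> * c\<rceil> - 1))) (at_left c)"
    and "\<forall>\<^sub>F y in at_left c. \<lfloor>\<beta> * y\<rfloor> = \<lceil>\<beta> * c\<rceil> - 1"
proof -
  define k where "k = \<lceil>\<beta> * c\<rceil> - 1"
  have k: "real_of_int k < \<beta> * c" "\<beta> * c \<le> real_of_int k + 1"
    unfolding k_def by linarith+
  have "((\<lambda>y. \<beta> * y) \<longlongrightarrow> \<beta> * c) (at_left c)"
    by (intro tendsto_intros)
  then have e1: "\<forall>\<^sub>F y in at_left c. real_of_int k < \<beta> * y"
    using k(1) by (rule order_tendstoD)
  have e2: "\<forall>\<^sub>F y in at_left c. y < c"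
    by (auto simp: eventually_at_filter)
  have e3: "\<forall>\<^sub>F y in at_left c. \<lfloor>\<beta> * y\<rfloor> = k \<and> y < c"
    using e1 e2
  proof eventually_elim
    case (elim y)
    then have "\<beta> * y < \<beta> * c" using assms by simp
    then have "\<lfloor>\<beta> * y\<rfloor> = k" using elim k by linarith
    then show ?case using elim by simp
  qed
  then show "\<forall>\<^sub>F y in at_left c. \<lfloor>\<beta> * y\<rfloor> = \<lceil>\<beta> * c\<rceil> - 1"
    unfolding k_def by eventually_elim simp
  have "((\<lambda>y. \<beta> * y - real_of_int k) \<longlongrightarrow> \<beta> * c - real_of_int k) (at_left c)"
    by (intro tendsto_intros)
  then have "(beta_map \<beta> \<longlongrightarrow> \<beta> * c - real_of_int k) (at_left c)"
    by (rule Lim_transform_eventually) (use e3 in eventually_elim, simp add: beta_map_def)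
  moreover have "\<forall>\<^sub>F y in at_left c. beta_map \<beta> y \<in> {..<\<beta> * c - real_of_int k} \<and> beta_map \<beta> y \<noteq> \<beta> * c - real_of_int k"
    using e3 by eventually_elim (use assms in \<open>auto simp: beta_map_def\<close>)
  ultimately show "filterlim (beta_map \<beta>) (at_left (\<beta> * c - real_of_int (\<lceil>\<beta> * c\<rceil> - 1))) (at_left c)"
    unfolding k_def[symmetric] filterlim_at by auto
qed

text \<open>The limit defining \<open>quasi_greedy_one\<close> exists, so that its definite description is proper.\<close>

lemma tendsto_quasi_greedy_one:
  assumes "\<beta> > 1"
  shows "(greedy_digits \<beta> \<longlongrightarrow> quasi_greedy_one \<beta>) (at_left 1)"
proof -
  have ev: "\<exists>d. \<forall>\<^sub>F y in at_left 1. greedy_digits \<beta> y n = d" for n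
  proof -
    have "\<exists>c. filterlim (beta_map \<beta> ^^ n) (at_left c) (at_left (1::real))"
    proof (induction n)
      case 0
      show ?case by (intro exI[of _ 1]) (simp add: id_def filterlim_ident)
    next
      case (Suc n)
      then obtain c where "filterlim (beta_map \<beta> ^^ n) (at_left c) (at_left (1::real))" by blast
      from filterlim_compose[OF beta_map_at_left(1)[OF assms] this] show ?case
        by (auto simp: comp_def)
    qed
    then obtain c where "filterlim (beta_map \<beta> ^^ n) (at_left c) (at_left (1::real))" by blast
    from eventually_compose_filterlim[OF beta_map_at_left(2)[OF assms] this] show ?thesis
      unfolding greedy_digits_def by (auto elim!: eventually_mono)
  qed
  have coord: "(greedy_digits \<beta> \<longlongrightarrow> l) (at_left 1) \<longleftrightarrow>
      (\<forall>n. \<forall>\<^sub>F y in at_left 1. greedy_digits \<beta> y n = l n)" for l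
    using limitin_componentwise[of "\<lambda>_. euclidean" UNIV "greedy_digits \<beta>" l "at_left 1"]
    by (simp add: euclidean_product_topology nhds_discrete filterlim_principal)
  obtain l where l: "\<forall>n. \<forall>\<^sub>F y in at_left 1. greedy_digits \<beta> y n = l n"
    using ev by metis
  have "l' = l" if "\<forall>n. \<forall>\<^sub>F y in at_left 1. greedy_digits \<beta> y n = l' n" for l'
  proof
    fix n
    have "\<forall>\<^sub>F y in at_left (1::real). l' n = l n"
      using that[rule_format, of n] l[rule_format, of n] by eventually_elim simp
    then show "l' n = l n" by (simp add: trivial_limit_at_left_real)
  qed
  then have "\<exists>!l. (greedy_digits \<beta> \<longlongrightarrow> l) (at_left 1)"
    unfolding coord using l by blast
  then show ?thesis
    unfolding quasi_greedy_one_def by (rule theI')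
qed

definition beta_shift :: "real \<Rightarrow> (nat \<Rightarrow> nat) set" where
  "beta_shift \<beta> = {x \<in> binary_seqs. \<forall>n. lex_le ((shift_seq ^^ n) x) (quasi_greedy_one \<beta>)}"

definition freq_set :: "real \<Rightarrow> real \<Rightarrow> (nat \<Rightarrow> nat) set" where
  "freq_set \<beta> \<alpha> =
     {x \<in> beta_shift \<beta>. (\<lambda>n. (1 / real n) * (\<Sum>i<n. real (x i))) \<longlonglongrightarrow> \<alpha>}"

lemma Metric_space_dist_beta:
  assumes "\<beta> > 1"
  shows "Metric_space binary_seqs (dist_beta \<beta>)"
proof
  fix x y z :: "nat \<Rightarrow> nat"
  show "0 \<le> dist_beta \<beta> x y" by (simp add: dist_beta_def)
  show "dist_beta \<beta> x y = dist_beta \<beta> y x"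
    unfolding dist_beta_def by (simp add: eq_commute)
  show "(dist_beta \<beta> x y = 0) = (x = y)"
    using assms by (simp add: dist_beta_def)
  show "dist_beta \<beta> x z \<le> dist_beta \<beta> x y + dist_beta \<beta> y z"
  proof (cases "x = y \<or> y = z \<or> x = z")
    case True
    then show ?thesis by (elim disjE) (simp_all add: dist_beta_def)
  next
    case False
    define m where "m u v = (LEAST k. u k \<noteq> v k)" for u v :: "nat \<Rightarrow> nat"
    have "x (m x z) \<noteq> z (m x z)"
      unfolding m_def by (rule LeastI_ex) (use False in \<open>auto simp: fun_eq_iff\<close>)
    then have "x (m x z) \<noteq> y (m x z) \<or> y (m x z) \<noteq> z (m x z)" by auto
    then have "m x y \<le> m x z \<or> m y z \<le> m x z"
      unfolding m_def[of x y] m_def[of y z] by (auto intro: Least_le)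
    then have "\<beta> powr (- real (m x z)) \<le> \<beta> powr (- real (m x y)) \<or>
        \<beta> powr (- real (m x z)) \<le> \<beta> powr (- real (m y z))"
      using assms by auto
    moreover have "\<beta> powr (- real (m x y)) \<ge> 0" "\<beta> powr (- real (m y z)) \<ge> 0" by auto
    ultimately have "\<beta> powr (- real (m x z)) \<le> \<beta> powr (- real (m x y)) + \<beta> powr (- real (m y z))"
      by linarith
    then show ?thesis
      using False by (simp add: dist_beta_def m_def)
  qed
qed

end

theory Submission
  imports Defs "HOL-Probability.Probability" "HOL-Real_Asymp.Real_Asymp"
begin

text \<open>The quasi-greedy expansion of \<open>1\<close> is \<open>(1 0\<^sup>N)\<^sup>\<infinity>\<close>, so the beta-shift consists of the
  sequences in which every \<open>1\<close> is followed by at least \<open>N\<close> zeros, that is, of the free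
  concatenations of the blocks \<open>0\<close> and \<open>1 0\<^sup>N\<close>. Under this coding, frequency \<open>\<alpha>\<close> of ones becomes
  frequency \<open>q = \<alpha> / (1 - N \<alpha>)\<close> of the long block. Give the blocks independent probabilities
  \<open>1 - q\<close> and \<open>q\<close>. Along every coding sequence with frequency \<open>q\<close> the weight of the first \<open>n\<close>
  blocks decays like \<open>exp (- n H(q))\<close>, where \<open>H(q)\<close> is the entropy, while their total length grows
  like \<open>n (1 + N q)\<close>; the dimension is therefore \<open>H(q) / ((1 + N q) log \<beta>)\<close>. The upper bound
  holds because the weights of the coding words of a given length sum to \<open>1\<close>; the lower bound is
  the mass distribution principle for the Bernoulli measure, for which the sequences of frequency
  \<open>q\<close> are typical by the strong law of large numbers.\<close>

section \<open>The beta-shift as a run-length constrained shift\<close>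

text \<open>Convergence in a product of discrete topologies means that every coordinate is
  eventually constant, so the digits of the limit can be determined one at a time.\<close>

lemma quasi_greedy_one_eqI:
  assumes "\<beta> > 1" "\<And>n. \<forall>\<^sub>F y in at_left 1. greedy_digits \<beta> y n = l n"
  shows "quasi_greedy_one \<beta> = l"
proof
  fix n
  have "((\<lambda>y. greedy_digits \<beta> y n) \<longlongrightarrow> quasi_greedy_one \<beta> n) (at_left 1)"
    using tendsto_quasi_greedy_one[OF assms(1)]
      limitin_componentwise[of "\<lambda>_. euclidean" UNIV "greedy_digits \<beta>" "quasi_greedy_one \<beta>" "at_left 1"]
    by (simp add: euclidean_product_topology)
  then have "\<forall>\<^sub>F y in at_left (1::real). greedy_digits \<beta> y n = quasi_greedy_one \<beta> n"
    by (simp add: nhds_discrete filterlim_principal)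
  with assms(2)[of n] have "\<forall>\<^sub>F y in at_left (1::real). quasi_greedy_one \<beta> n = l n"
    by eventually_elim simp
  then show "quasi_greedy_one \<beta> n = l n"
    by (simp add: trivial_limit_at_left_real)
qed

text \<open>Each iterate of \<open>beta_map\<close> sends left neighbourhoods to left
  neighbourhoods, so the digits come from following the left limits of the orbit of
  \<open>1\<close>. The equation for \<beta> makes these limits periodic with period
  \<open>N + 1\<close>.\<close>

lemma quasi_greedy_one_eq:
  fixes \<beta> :: real
  assumes \<beta>: "\<beta> > 1" and N: "N \<ge> 1" and root: "\<beta> ^ (N + 1) - \<beta> ^ N - 1 = 0"
  shows "quasi_greedy_one \<beta> = (\<lambda>n. of_bool (Suc N dvd n))"
proof (rule quasi_greedy_one_eqI[OF \<beta>])
  \<comment> \<open>\<open>c n\<close> is the left limit at \<open>1\<close> of the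
    \<open>n\<close>-th iterate: \<open>1\<close>, then
    \<open>\<beta> - 1 = 1 / \<beta> ^ N\<close>, then repeatedly multiplied by \<beta> until it is
    \<open>1\<close> again.\<close>
  define c where "c n = (if Suc N dvd n then 1 else \<beta> ^ (n mod Suc N - 1) / \<beta> ^ N)" for n
  define d :: "nat \<Rightarrow> int" where "d n = of_bool (Suc N dvd n)" for n
  have r: "\<beta> - 1 = 1 / \<beta> ^ N"
    using root \<beta> by (simp add: field_simps)
  have "1 / \<beta> ^ N \<le> 1" using \<beta> by simp
  with r have "\<beta> \<le> 2" by linarith
  have c: "\<lceil>\<beta> * c n\<rceil> - 1 = d n \<and> \<beta> * c n - real_of_int (d n) = c (Suc n)" for n
  proof (cases "Suc N dvd n")
    case True
    then have "\<not> Suc N dvd Suc n" "Suc n mod Suc N = 1"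
      using N by (auto simp: mod_Suc dvd_eq_mod_eq_0)
    moreover have "\<lceil>\<beta>\<rceil> = 2" using \<beta> \<open>\<beta> \<le> 2\<close> by (simp add: ceiling_eq_iff)
    ultimately show ?thesis using True r by (simp add: c_def d_def)
  next
    case False
    define m where "m = n mod Suc N"
    have m: "0 < m" "m \<le> N"
      using False by (auto simp: m_def dvd_eq_mod_eq_0 less_Suc_eq_le[symmetric])
    have e: "\<beta> * c n = \<beta> ^ m / \<beta> ^ N"
      using False m \<beta> by (simp add: c_def m_def[symmetric] power_eq_if)
    \<comment> \<open>Equality occurs at \<open>m = N\<close>. Approached from the left, the value
      \<open>1\<close> still yields the digit \<open>0\<close>, and the orbit returns to
      \<open>1\<close> instead of dropping to \<open>0\<close>.\<close>
    have "\<beta> ^ m / \<beta> ^ N \<le> 1" using m \<beta> by simp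
    moreover have "\<beta> ^ m / \<beta> ^ N > 0" using \<beta> by simp
    ultimately have "\<lceil>\<beta> * c n\<rceil> = 1" unfolding e by (simp add: ceiling_eq_iff)
    moreover have "c (Suc n) = \<beta> ^ m / \<beta> ^ N"
    proof (cases "m = N")
      case True
      then have "Suc N dvd Suc n" by (simp add: m_def mod_Suc dvd_eq_mod_eq_0)
      then show ?thesis using True \<beta> by (simp add: c_def)
    next
      case neq: False
      then have "Suc n mod Suc N = Suc m" by (simp add: m_def mod_Suc)
      then show ?thesis by (simp add: c_def dvd_eq_mod_eq_0)
    qed
    ultimately show ?thesis using False e by (simp add: d_def)
  qed
  have lim: "filterlim (beta_map \<beta> ^^ n) (at_left (c n)) (at_left 1)" for n
  proof (induction n)
    case 0
    show ?case by (simp add: c_def id_def filterlim_ident)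
  next
    case (Suc n)
    have "filterlim (beta_map \<beta>) (at_left (c (Suc n))) (at_left (c n))"
      using beta_map_at_left(1)[OF \<beta>, of "c n"] c[of n] by simp
    from filterlim_compose[OF this Suc.IH] show ?case by (simp add: comp_def)
  qed
  show "\<forall>\<^sub>F y in at_left 1. greedy_digits \<beta> y n = of_bool (Suc N dvd n)" for n
    using eventually_compose_filterlim[OF beta_map_at_left(2)[OF \<beta>] lim, of n]
  proof eventually_elim
    case (elim y)
    then have "\<lfloor>\<beta> * (beta_map \<beta> ^^ n) y\<rfloor> = d n" using c[of n] by simp
    then show ?case unfolding greedy_digits_def by (simp add: d_def)
  qed
qed

section \<open>The lexicographic condition as a gap condition\<close>

definition gap_seqs :: "nat \<Rightarrow> (nat \<Rightarrow> nat) set" where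
  "gap_seqs N = {x \<in> binary_seqs. \<forall>i j. x i = 1 \<longrightarrow> i < j \<longrightarrow> j \<le> i + N \<longrightarrow> x j = 0}"

lemma shift_seq_funpow: "(shift_seq ^^ n) x = (\<lambda>i. x (n + i))"
  by (induction n) (auto simp: shift_seq_def)

text \<open>The first disagreement must fall on a multiple of \<open>N + 1\<close>: otherwise the
  preceding multiple carries a one of \<open>x\<close>, which forces the zero that the bound has
  there. At a multiple the bound is \<open>1\<close>, so disagreement means that \<open>x\<close> is
  smaller.\<close>

lemma lex_le_gap_seq:
  assumes "x \<in> gap_seqs N"
  shows "lex_le x (\<lambda>n. of_bool (Suc N dvd n))"
proof (cases "x = (\<lambda>n. of_bool (Suc N dvd n))")
  case False
  define k where "k = (LEAST k. x k \<noteq> of_bool (Suc N dvd k))"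
  have k: "x k \<noteq> of_bool (Suc N dvd k)"
    unfolding k_def by (rule LeastI_ex) (use False in \<open>simp only: fun_eq_iff not_all\<close>)
  have below: "x i = of_bool (Suc N dvd i)" if "i < k" for i
    using not_less_Least[of i "\<lambda>k. x k \<noteq> of_bool (Suc N dvd k)"] that by (auto simp: k_def)
  have bin: "x k \<in> {0, 1}"
    using assms by (auto simp: gap_seqs_def binary_seqs_def)
  have "Suc N dvd k"
  proof (rule ccontr)
    assume nd: "\<not> Suc N dvd k"
    define i where "i = k - k mod Suc N"
    have "Suc N dvd i" unfolding i_def by (rule dvd_minus_mod)
    have "k mod Suc N < Suc N" "k mod Suc N \<le> k" "k mod Suc N > 0"
      using nd by (auto simp: dvd_eq_mod_eq_0)
    then have i: "i < k" "k \<le> i + N" unfolding i_def by linarith+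
    have "x i = 1" using below[OF i(1)] \<open>Suc N dvd i\<close> by simp
    then have "x k = 0" using i assms by (auto simp: gap_seqs_def)
    then show False using k nd by simp
  qed
  then have "x k < of_bool (Suc N dvd k)" using k bin by auto
  with below show ?thesis unfolding lex_le_def less_fun_def by blast
qed (simp add: lex_le_def)

text \<open>Apply the lexicographic bound to the shift that starts at a one. A strict drop needs an
  entry \<open>1\<close> of the bound, hence a nonzero multiple of \<open>N + 1\<close>, so the next
  \<open>N\<close> entries agree with the bound and vanish. Conversely, the gap condition is shift
  invariant and \<open>lex_le_gap_seq\<close> applies to every shift.\<close>

lemma beta_shift_eq_gap_seqs:
  assumes "\<beta> > 1" "N \<ge> 1" "\<beta> ^ (N + 1) - \<beta> ^ N - 1 = 0"
  shows "beta_shift \<beta> = gap_seqs N"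
proof (intro equalityI subsetI)
  fix x assume x: "x \<in> beta_shift \<beta>"
  have "x j = 0" if ij: "x i = 1" "i < j" "j \<le> i + N" for i j
  proof -
    have nd: "\<not> Suc N dvd k" if "0 < k" "k \<le> j - i" for k
      using ij that dvd_imp_le[of "Suc N" k] by linarith
    have "lex_le (\<lambda>k. x (i + k)) (\<lambda>n. of_bool (Suc N dvd n))"
      using x by (auto simp: beta_shift_def shift_seq_funpow quasi_greedy_one_eq[OF assms])
    then consider "(\<lambda>k. x (i + k)) = (\<lambda>n. of_bool (Suc N dvd n))"
      | k where "x (i + k) < of_bool (Suc N dvd k)" "\<And>l. l < k \<Longrightarrow> x (i + l) = of_bool (Suc N dvd l)"
      by (auto simp: lex_le_def less_fun_def)
    then have "x (i + (j - i)) = of_bool (Suc N dvd (j - i))"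
    proof cases
      case (2 k)
      have "Suc N dvd k" using 2(1) by (cases "Suc N dvd k") auto
      moreover have "k \<noteq> 0" using 2(1) ij(1) by (cases "k = 0") auto
      ultimately have "j - i < k" using nd[of k] by linarith
      then show ?thesis by (rule 2(2))
    qed (simp add: fun_eq_iff)
    then show ?thesis using nd[of "j - i"] ij by simp
  qed
  then show "x \<in> gap_seqs N" using x by (auto simp: gap_seqs_def beta_shift_def)
next
  fix x assume x: "x \<in> gap_seqs N"
  then have "(\<lambda>i. x (n + i)) \<in> gap_seqs N" for n
    by (simp add: gap_seqs_def binary_seqs_def)
  from lex_le_gap_seq[OF this] x show "x \<in> beta_shift \<beta>"
    by (auto simp: beta_shift_def shift_seq_funpow quasi_greedy_one_eq[OF assms] gap_seqs_def)
qed

section \<open>Coding by free binary sequences\<close>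

definition ones :: "(nat \<Rightarrow> bool) \<Rightarrow> nat \<Rightarrow> nat" where
  "ones \<omega> n = (\<Sum>i<n. of_bool (\<omega> i))"

definition block_start :: "nat \<Rightarrow> (nat \<Rightarrow> bool) \<Rightarrow> nat \<Rightarrow> nat" where
  "block_start N \<omega> j = j + N * ones \<omega> j"

text \<open>The concatenation of blocks, where \<open>False\<close> codes the block \<open>0\<close> and \<open>True\<close> codes the block
  \<open>1\<close> followed by \<open>N\<close> zeros.\<close>

definition concat_blocks :: "nat \<Rightarrow> (nat \<Rightarrow> bool) \<Rightarrow> nat \<Rightarrow> nat" where
  "concat_blocks N \<omega> t = of_bool (\<exists>j. \<omega> j \<and> block_start N \<omega> j = t)"

lemma ones_0 [simp]: "ones \<omega> 0 = 0"
  and ones_Suc: "ones \<omega> (Suc n) = ones \<omega> n + of_bool (\<omega> n)"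
  by (simp_all add: ones_def)

lemma ones_le: "ones \<omega> n \<le> n"
  by (induction n) (auto simp: ones_Suc)

lemma ones_cong: "(\<And>i. i < n \<Longrightarrow> \<omega> i = \<omega>' i) \<Longrightarrow> ones \<omega> n = ones \<omega>' n"
  unfolding ones_def by (intro sum.cong) auto

lemma block_start_0 [simp]: "block_start N \<omega> 0 = 0"
  and block_start_Suc: "block_start N \<omega> (Suc j) = Suc (block_start N \<omega> j) + (if \<omega> j then N else 0)"
  by (simp_all add: block_start_def ones_Suc)

lemma strict_mono_block_start: "strict_mono (block_start N \<omega>)"
  by (simp add: strict_mono_Suc_iff block_start_Suc)

lemma block_start_less_iff [simp]: "block_start N \<omega> i < block_start N \<omega> j \<longleftrightarrow> i < j"
  and block_start_le_iff [simp]: "block_start N \<omega> i \<le> block_start N \<omega> j \<longleftrightarrow> i \<le> j"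
  and block_start_eq_iff [simp]: "block_start N \<omega> i = block_start N \<omega> j \<longleftrightarrow> i = j"
  by (fact strict_mono_less[OF strict_mono_block_start]
      strict_mono_less_eq[OF strict_mono_block_start] strict_mono_eq[OF strict_mono_block_start])+

lemma le_block_start: "j \<le> block_start N \<omega> j"
  by (simp add: block_start_def)

lemma block_start_cong:
  "(\<And>i. i < j \<Longrightarrow> \<omega> i = \<omega>' i) \<Longrightarrow> block_start N \<omega> j = block_start N \<omega>' j"
  unfolding block_start_def by (metis ones_cong)

lemma block_containing:
  obtains j where "block_start N \<omega> j \<le> t" "t < block_start N \<omega> (Suc j)"
proof -
  have "\<exists>j. t < block_start N \<omega> j"
    using le_block_start[of "Suc t" N \<omega>] by (intro exI[of _ "Suc t"]) simp
  then have ex: "\<exists>j. t < block_start N \<omega> (Suc j)"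
    by (metis not0_implies_Suc block_start_0 not_less_zero)
  define j where "j = (LEAST j. t < block_start N \<omega> (Suc j))"
  have j: "t < block_start N \<omega> (Suc j)" unfolding j_def by (rule LeastI_ex[OF ex])
  have "block_start N \<omega> j \<le> t"
  proof (cases j)
    case (Suc i)
    then have "\<not> t < block_start N \<omega> (Suc i)"
      using not_less_Least[of i "\<lambda>j. t < block_start N \<omega> (Suc j)"] by (simp add: j_def)
    then show ?thesis using Suc by simp
  qed simp
  with j that show thesis by blast
qed

lemma concat_blocks_block_start [simp]:
  "concat_blocks N \<omega> (block_start N \<omega> j) = of_bool (\<omega> j)"
  by (auto simp: concat_blocks_def)

lemma concat_blocks_inside_block:
  assumes "block_start N \<omega> j < t" "t < block_start N \<omega> (Suc j)"
  shows "concat_blocks N \<omega> t = 0"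
proof -
  have "block_start N \<omega> i \<noteq> t" for i
  proof
    assume "block_start N \<omega> i = t"
    with assms have "block_start N \<omega> j < block_start N \<omega> i"
      "block_start N \<omega> i < block_start N \<omega> (Suc j)" by (simp_all only:)
    then show False unfolding block_start_less_iff by simp
  qed
  then show ?thesis by (auto simp: concat_blocks_def)
qed

section \<open>Image and injectivity of the coding\<close>

lemma concat_blocks_in_gap_seqs: "concat_blocks N \<omega> \<in> gap_seqs N"
proof -
  have "concat_blocks N \<omega> t = 0" if one: "concat_blocks N \<omega> i = 1" and it: "i < t" "t \<le> i + N" for i t
  proof -
    obtain j where "\<omega> j" "block_start N \<omega> j = i"
      using one by (auto simp: concat_blocks_def of_bool_def split: if_splits)
    then show ?thesis using it
      by (intro concat_blocks_inside_block[of N \<omega> j]) (simp_all add: block_start_Suc)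
  qed
  moreover have "concat_blocks N \<omega> \<in> binary_seqs"
    by (simp add: binary_seqs_def concat_blocks_def)
  ultimately show ?thesis unfolding gap_seqs_def by blast
qed

text \<open>A gap sequence is parsed from left to right: a one opens a long block, whose remaining
  entries vanish by the gap condition, and a zero is a short block by itself.\<close>

lemma gap_seqs_eq_range: "gap_seqs N = range (concat_blocks N)"
proof (intro equalityI subsetI)
  fix x assume x: "x \<in> gap_seqs N"
  \<comment> \<open>\<open>T\<close> recurses on \<open>x\<close> alone, so that \<omega> can be
    read off at the positions \<open>T j\<close>; only afterwards do these turn out to be the block
    starts of \<omega>.\<close>
  define T where "T = rec_nat 0 (\<lambda>_ t. Suc t + (if x t = 1 then N else 0))"
  define \<omega> where "\<omega> j \<longleftrightarrow> x (T j) = 1" for j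
  have T: "block_start N \<omega> j = T j" for j
    by (induction j) (auto simp: block_start_Suc T_def \<omega>_def)
  have bin: "x t = 0 \<or> x t = 1" for t
    using x by (auto simp: gap_seqs_def binary_seqs_def)
  have "concat_blocks N \<omega> t = x t" for t
  proof -
    obtain j where j: "block_start N \<omega> j \<le> t" "t < block_start N \<omega> (Suc j)"
      by (rule block_containing)
    show ?thesis
    proof (cases "t = block_start N \<omega> j")
      case True
      then have "concat_blocks N \<omega> t = of_bool (\<omega> j)" by simp
      then show ?thesis using True bin[of "T j"] by (auto simp: T \<omega>_def)
    next
      case False
      then have lt: "block_start N \<omega> j < t" using j by simp
      then have "\<omega> j" "t \<le> T j + N"
        using j(2) by (auto simp: block_start_Suc T split: if_splits)
      then have "x t = 0" using x lt by (auto simp: gap_seqs_def \<omega>_def T)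
      then show ?thesis using concat_blocks_inside_block[OF lt j(2)] by simp
    qed
  qed
  then have "concat_blocks N \<omega> = x" by (rule ext)
  then show "x \<in> range (concat_blocks N)" by (metis rangeI)
next
  fix x assume "x \<in> range (concat_blocks N)"
  then obtain \<omega> where "x = concat_blocks N \<omega>" by (rule rangeE)
  then show "x \<in> gap_seqs N" by (simp add: concat_blocks_in_gap_seqs)
qed

text \<open>A position before \<open>block_start N \<omega> j\<close> lies in one of the first
  \<open>j\<close> blocks, whose place and content depend only on the letters up to its own. This
  bounds the diameters of images of cylinders.\<close>

lemma concat_blocks_cong:
  assumes eq: "\<And>i. i < j \<Longrightarrow> \<omega> i = \<omega>' i" and t: "t < block_start N \<omega> j"
  shows "concat_blocks N \<omega> t = concat_blocks N \<omega>' t"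
proof -
  obtain i where i: "block_start N \<omega> i \<le> t" "t < block_start N \<omega> (Suc i)"
    by (rule block_containing)
  then have "block_start N \<omega> i < block_start N \<omega> j" using t by linarith
  then have "i < j" by simp
  then have eq': "\<omega>' k = \<omega> k" if "k < Suc i" for k
    using eq[of k] that by simp
  have start: "block_start N \<omega>' i = block_start N \<omega> i"
      "block_start N \<omega>' (Suc i) = block_start N \<omega> (Suc i)"
    by (rule block_start_cong, rule eq', simp)+
  show ?thesis
  proof (cases "t = block_start N \<omega> i")
    case True
    with start(1) have "concat_blocks N \<omega>' t = of_bool (\<omega>' i)"
      using concat_blocks_block_start[of N \<omega>' i] by simp
    then show ?thesis using eq[OF \<open>i < j\<close>] True by simp
  next
    case False
    then show ?thesis
      using i start by (simp add: concat_blocks_inside_block[of N _ i t])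
  qed
qed

text \<open>Unique decoding: once the earlier letters agree, both sequences start block
  \<open>i\<close> at the same position, and the entry there reveals the letter. The bound on
  \<open>block_start N \<omega> j\<close> keeps that position inside the common prefix.\<close>

lemma concat_blocks_eq_imp_eq:
  assumes eq: "\<And>t. t < n \<Longrightarrow> concat_blocks N \<omega> t = concat_blocks N \<omega>' t"
    and j: "block_start N \<omega> j \<le> n" and i: "i < j"
  shows "\<omega> i = \<omega>' i"
  using i
proof (induction i rule: less_induct)
  case (less i)
  have "\<omega>' k = \<omega> k" if "k < i" for k
    using less.IH[OF that less_trans[OF that less.prems]] by (rule sym)
  then have "block_start N \<omega>' i = block_start N \<omega> i"
    by (rule block_start_cong)
  then have "concat_blocks N \<omega>' (block_start N \<omega> i) = of_bool (\<omega>' i)"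
    using concat_blocks_block_start[of N \<omega>' i] by simp
  moreover have "block_start N \<omega> i < n"
    by (rule less_le_trans[OF _ j]) (use less.prems in simp)
  ultimately have "(of_bool (\<omega> i) :: nat) = of_bool (\<omega>' i)"
    using eq[of "block_start N \<omega> i"] by (simp only: concat_blocks_block_start)
  then show ?case by (simp only: of_bool_eq_iff)
qed

lemma sum_concat_blocks: "(\<Sum>t<block_start N \<omega> j. concat_blocks N \<omega> t) = ones \<omega> j"
proof (induction j)
  case (Suc j)
  define a b where "a = block_start N \<omega> j" and "b = block_start N \<omega> (Suc j)"
  have "a < b" by (simp add: a_def b_def)
  then have "(\<Sum>t<b. concat_blocks N \<omega> t) =
      (\<Sum>t<a. concat_blocks N \<omega> t) + (\<Sum>t\<in>{a..<b}. concat_blocks N \<omega> t)"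
    unfolding lessThan_atLeast0 by (simp add: sum.atLeastLessThan_concat)
  also have "(\<Sum>t\<in>{a..<b}. concat_blocks N \<omega> t) =
      concat_blocks N \<omega> a + (\<Sum>t\<in>{Suc a..<b}. concat_blocks N \<omega> t)"
    using \<open>a < b\<close> by (rule sum.atLeast_Suc_lessThan)
  also have "(\<Sum>t\<in>{Suc a..<b}. concat_blocks N \<omega> t) = 0"
    by (intro sum.neutral ballI concat_blocks_inside_block[of N \<omega> j]) (simp_all add: a_def b_def)
  also have "concat_blocks N \<omega> a = of_bool (\<omega> j)" by (simp add: a_def)
  finally show ?case using Suc.IH by (simp add: a_def b_def ones_Suc)
qed simp

section \<open>Frequencies under the coding\<close>

lemma ratio_Suc_tendsto_1: "(\<lambda>n. real (Suc n) / real n) \<longlonglongrightarrow> 1"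
  by real_asymp

lemma block_start_ratio_tendsto:
  assumes "(\<lambda>n. real (ones \<omega> n) / real n) \<longlonglongrightarrow> q"
  shows "(\<lambda>n. real (block_start N \<omega> n) / real n) \<longlonglongrightarrow> 1 + real N * q"
    and "(\<lambda>n. real (block_start N \<omega> (Suc n)) / real n) \<longlonglongrightarrow> 1 + real N * q"
proof -
  have "(\<lambda>n. 1 + real N * (real (ones \<omega> n) / real n)) \<longlonglongrightarrow> 1 + real N * q"
    by (intro tendsto_intros assms)
  moreover have "\<forall>\<^sub>F n in sequentially.
      1 + real N * (real (ones \<omega> n) / real n) = real (block_start N \<omega> n) / real n"
    using eventually_gt_at_top[of 0]
    by eventually_elim (simp add: block_start_def add_divide_distrib)
  ultimately show 1: "(\<lambda>n. real (block_start N \<omega> n) / real n) \<longlonglongrightarrow> 1 + real N * q"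
    by (rule Lim_transform_eventually)
  have "(\<lambda>n. real (block_start N \<omega> (Suc n)) / real (Suc n) * (real (Suc n) / real n))
      \<longlonglongrightarrow> (1 + real N * q) * 1"
    by (intro tendsto_mult ratio_Suc_tendsto_1 LIMSEQ_Suc[OF 1])
  then show "(\<lambda>n. real (block_start N \<omega> (Suc n)) / real n) \<longlonglongrightarrow> 1 + real N * q"
    by (simp del: of_nat_Suc)
qed

text \<open>The maps \<open>\<alpha> / (1 - N \<alpha>)\<close> and \<open>q / (1 + N q)\<close> are
  mutually inverse. One direction evaluates the averages along the block starts; the other
  interpolates between consecutive block starts.\<close>

lemma frequency_concat_blocks_iff:
  fixes \<alpha> :: real
  assumes \<alpha>: "0 \<le> \<alpha>" "real N * \<alpha> < 1"
  shows "(\<lambda>n. (1 / real n) * (\<Sum>i<n. real (concat_blocks N \<omega> i))) \<longlonglongrightarrow> \<alpha> \<longleftrightarrow>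
    (\<lambda>n. real (ones \<omega> n) / real n) \<longlonglongrightarrow> \<alpha> / (1 - real N * \<alpha>)"
    (is "?F \<longlonglongrightarrow> \<alpha> \<longleftrightarrow> ?R")
proof
  define b where "b = block_start N \<omega>"
  have b: "strict_mono b" unfolding b_def by (rule strict_mono_block_start)
  have F: "?F (b j) = real (ones \<omega> j) / real (b j)" for j
    using sum_concat_blocks[of N \<omega> j] by (simp add: b_def flip: of_nat_sum)
  assume "?F \<longlonglongrightarrow> \<alpha>"
  from LIMSEQ_subseq_LIMSEQ[OF this b] have lim: "(\<lambda>j. real (ones \<omega> j) / real (b j)) \<longlonglongrightarrow> \<alpha>"
    unfolding comp_def F .
  have "(\<lambda>j. (real (ones \<omega> j) / real (b j)) / (1 - real N * (real (ones \<omega> j) / real (b j))))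
      \<longlonglongrightarrow> \<alpha> / (1 - real N * \<alpha>)"
    using \<alpha> by (intro tendsto_intros lim) auto
  moreover have "\<forall>\<^sub>F j in sequentially.
      (real (ones \<omega> j) / real (b j)) / (1 - real N * (real (ones \<omega> j) / real (b j))) =
      real (ones \<omega> j) / real j"
    using eventually_gt_at_top[of 0]
  proof eventually_elim
    case (elim j)
    \<comment> \<open>Since \<open>j\<close> is \<open>b j\<close> minus \<open>N\<close> times the
      number of ones, the denominator becomes \<open>j / b j\<close>, and \<open>b j\<close>
      cancels.\<close>
    have "real (b j) = real j + real N * real (ones \<omega> j)" by (simp add: b_def block_start_def)
    moreover from this have b_pos: "real (b j) > 0" using elim by (simp add: add_pos_nonneg)
    ultimately have "1 - real N * (real (ones \<omega> j) / real (b j)) = real j / real (b j)"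
      by (simp add: field_simps)
    then show ?case using b_pos by simp
  qed
  ultimately show ?R by (rule Lim_transform_eventually)
next
  define b where "b = block_start N \<omega>"
  define K where "K n = (\<Sum>i<n. concat_blocks N \<omega> i)" for n
  define q where "q = \<alpha> / (1 - real N * \<alpha>)"
  assume R: ?R
  note lim = R[folded q_def] and b_lim = block_start_ratio_tendsto[OF R, folded q_def, of N, folded b_def]
  have pos: "1 + real N * q = 1 / (1 - real N * \<alpha>)" "1 + real N * q > 0"
    using \<alpha> by (simp_all add: q_def field_simps add_pos_nonneg)
  then have \<alpha>_eq: "q / (1 + real N * q) = \<alpha>" using \<alpha> by (simp add: q_def)
  have low: "(\<lambda>j. real (ones \<omega> j) / real (b (Suc j))) \<longlonglongrightarrow> \<alpha>"
  proof -
    have "(\<lambda>j. (real (ones \<omega> j) / real j) / (real (b (Suc j)) / real j)) \<longlonglongrightarrow> \<alpha>"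
      unfolding \<alpha>_eq[symmetric] using pos(2) by (intro tendsto_intros lim b_lim) auto
    moreover have "\<forall>\<^sub>F j in sequentially. (real (ones \<omega> j) / real j) / (real (b (Suc j)) / real j) =
        real (ones \<omega> j) / real (b (Suc j))"
      using eventually_gt_at_top[of 0] by eventually_elim simp
    ultimately show ?thesis by (rule Lim_transform_eventually)
  qed
  have up: "(\<lambda>j. real (ones \<omega> (Suc j)) / real (b j)) \<longlonglongrightarrow> \<alpha>"
  proof -
    have "(\<lambda>j. (real (ones \<omega> (Suc j)) / real (Suc j) * (real (Suc j) / real j)) / (real (b j) / real j))
        \<longlonglongrightarrow> q * 1 / (1 + real N * q)"
      using pos(2) by (intro tendsto_divide tendsto_mult ratio_Suc_tendsto_1 LIMSEQ_Suc[OF lim] b_lim) auto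
    moreover have "\<forall>\<^sub>F j in sequentially.
        (real (ones \<omega> (Suc j)) / real (Suc j) * (real (Suc j) / real j)) / (real (b j) / real j) =
        real (ones \<omega> (Suc j)) / real (b j)"
      using eventually_gt_at_top[of 0] by eventually_elim (simp del: of_nat_Suc)
    ultimately have "(\<lambda>j. real (ones \<omega> (Suc j)) / real (b j)) \<longlonglongrightarrow> q * 1 / (1 + real N * q)"
      by (rule Lim_transform_eventually)
    then show ?thesis by (simp add: \<alpha>_eq)
  qed
  have "\<exists>j. b j \<le> n \<and> n < b (Suc j)" for n
    unfolding b_def by (metis block_containing)
  \<comment> \<open>\<open>J n\<close> is the index of the block containing position
    \<open>n\<close>. Both \<open>n\<close> and the number of ones before it lie between their
    values at the two ends of this block, so \<open>low\<close> and \<open>up\<close> squeeze the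
    average.\<close>
  then obtain J where J: "b (J n) \<le> n" "n < b (Suc (J n))" for n by metis
  have J_lim: "filterlim J at_top sequentially"
    unfolding filterlim_at_top
  proof
    fix m
    show "\<forall>\<^sub>F n in sequentially. m \<le> J n"
      using eventually_ge_at_top[of "b m"]
    proof eventually_elim
      case (elim n)
      with J(2)[of n] have "b m < b (Suc (J n))" by linarith
      then show ?case unfolding b_def block_start_less_iff by simp
    qed
  qed
  have K: "ones \<omega> (J n) \<le> K n" "K n \<le> ones \<omega> (Suc (J n))" for n
  proof -
    show "ones \<omega> (J n) \<le> K n"
      unfolding K_def sum_concat_blocks[of N \<omega> "J n", symmetric]
      by (rule sum_mono2) (use J(1)[of n] in \<open>auto simp: b_def\<close>)
    show "K n \<le> ones \<omega> (Suc (J n))"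
      unfolding K_def sum_concat_blocks[of N \<omega> "Suc (J n)", symmetric]
      by (rule sum_mono2) (use J(2)[of n] in \<open>auto simp: b_def\<close>)
  qed
  have "(\<lambda>n. real (K n) / real n) \<longlonglongrightarrow> \<alpha>"
  proof (rule tendsto_sandwich)
    show "(\<lambda>n. real (ones \<omega> (J n)) / real (b (Suc (J n)))) \<longlonglongrightarrow> \<alpha>"
      by (rule filterlim_compose[OF low J_lim])
    show "(\<lambda>n. real (ones \<omega> (Suc (J n))) / real (b (J n))) \<longlonglongrightarrow> \<alpha>"
      by (rule filterlim_compose[OF up J_lim])
    show "\<forall>\<^sub>F n in sequentially. real (ones \<omega> (J n)) / real (b (Suc (J n))) \<le> real (K n) / real n"
      using eventually_gt_at_top[of 0]
    proof eventually_elim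
      case (elim n)
      then show ?case using J(2)[of n] K(1)[of n] by (intro frac_le) auto
    qed
    have "\<forall>\<^sub>F n in sequentially. J n > 0"
      using eventually_compose_filterlim[OF eventually_gt_at_top J_lim] .
    then show "\<forall>\<^sub>F n in sequentially. real (K n) / real n \<le> real (ones \<omega> (Suc (J n))) / real (b (J n))"
    proof eventually_elim
      case (elim n)
      \<comment> \<open>Block \<open>0\<close> had to be excluded, because the upper bound divides
        by \<open>b (J n)\<close> and a quotient by zero would be \<open>0\<close>.\<close>
      then have "b (J n) > 0" using le_block_start[of "J n" N \<omega>] unfolding b_def by linarith
      then show ?case using J(1)[of n] K(2)[of n] by (intro frac_le) auto
    qed
  qed
  then show "?F \<longlonglongrightarrow> \<alpha>" by (simp add: K_def)
qed

section \<open>Bernoulli weights of cylinders and their entropy rate\<close>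

definition weight :: "real \<Rightarrow> (nat \<Rightarrow> bool) \<Rightarrow> nat \<Rightarrow> real" where
  "weight q \<omega> n = (\<Prod>i<n. if \<omega> i then q else 1 - q)"

definition bernoulli_entropy :: "real \<Rightarrow> real" where
  "bernoulli_entropy q = - q * ln q - (1 - q) * ln (1 - q)"

lemma weight_pos: "0 < q \<Longrightarrow> q < 1 \<Longrightarrow> 0 < weight q \<omega> n"
  unfolding weight_def by (intro prod_pos) auto

lemma ln_weight:
  assumes "0 < q" "q < 1"
  shows "ln (weight q \<omega> n) = real (ones \<omega> n) * ln q + (real n - real (ones \<omega> n)) * ln (1 - q)"
proof (induction n)
  case (Suc n)
  have "weight q \<omega> (Suc n) = weight q \<omega> n * (if \<omega> n then q else 1 - q)"
    by (simp add: weight_def)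
  then show ?case
    using Suc.IH assms weight_pos[OF assms, of \<omega> n] by (simp add: ln_mult ones_Suc algebra_simps)
qed (simp add: weight_def)

text \<open>A deterministic equipartition property: the weight depends on the first \<open>n\<close>
  letters only through the number of ones, so the frequency fixes its exponential rate for every
  such sequence, not merely almost surely.\<close>

lemma ln_weight_ratio_tendsto:
  assumes "0 < q" "q < 1" and lim: "(\<lambda>n. real (ones \<omega> n) / real n) \<longlonglongrightarrow> q"
  shows "(\<lambda>n. ln (weight q \<omega> n) / real n) \<longlonglongrightarrow> - bernoulli_entropy q"
proof -
  have "(\<lambda>n. real (ones \<omega> n) / real n * ln q + (1 - real (ones \<omega> n) / real n) * ln (1 - q))
      \<longlonglongrightarrow> q * ln q + (1 - q) * ln (1 - q)"
    by (intro tendsto_intros lim)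
  moreover have "\<forall>\<^sub>F n in sequentially.
      real (ones \<omega> n) / real n * ln q + (1 - real (ones \<omega> n) / real n) * ln (1 - q) =
      ln (weight q \<omega> n) / real n"
    using eventually_gt_at_top[of 0]
    by eventually_elim (simp add: ln_weight assms field_simps)
  ultimately have "(\<lambda>n. ln (weight q \<omega> n) / real n) \<longlonglongrightarrow> q * ln q + (1 - q) * ln (1 - q)"
    by (rule Lim_transform_eventually)
  then show ?thesis by (simp add: bernoulli_entropy_def add.commute)
qed

text \<open>For \<open>s\<close> above the critical exponent, the logarithm of the quotient of the
  two sides, divided by \<open>n\<close>, has a positive limit.\<close>

lemma eventually_powr_le_weight:
  assumes q: "0 < q" "q < 1" and \<beta>: "\<beta> > 1"
    and s: "bernoulli_entropy q < s * ((1 + real N * q) * ln \<beta>)"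
    and lim: "(\<lambda>n. real (ones \<omega> n) / real n) \<longlonglongrightarrow> q"
  shows "\<forall>\<^sub>F n in sequentially. \<beta> powr (- s * real (block_start N \<omega> n)) \<le> weight q \<omega> n"
proof -
  have "(\<lambda>n. ln (weight q \<omega> n) / real n + s * (real (block_start N \<omega> n) / real n * ln \<beta>))
      \<longlonglongrightarrow> - bernoulli_entropy q + s * ((1 + real N * q) * ln \<beta>)"
    by (intro tendsto_intros ln_weight_ratio_tendsto block_start_ratio_tendsto q lim)
  from order_tendstoD(1)[OF this, of 0] s
  have "\<forall>\<^sub>F n in sequentially.
      0 < ln (weight q \<omega> n) / real n + s * (real (block_start N \<omega> n) / real n * ln \<beta>)" by simp
  then show ?thesis using eventually_gt_at_top[of 0]
  proof eventually_elim
    case (elim n)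
    then have "0 < ln (weight q \<omega> n) + s * real (block_start N \<omega> n) * ln \<beta>"
      by (simp add: field_simps)
    then have "exp (- s * real (block_start N \<omega> n) * ln \<beta>) \<le> exp (ln (weight q \<omega> n))" by simp
    then show ?case using \<beta> weight_pos[OF q] by (simp add: powr_def)
  qed
qed

text \<open>The counterpart below the critical exponent. The index \<open>Suc n\<close> is chosen
  because a set whose elements first separate inside block \<open>n\<close> fixes only the first
  \<open>n\<close> letters, while its diameter is only bounded below through the next block start.
  The rate is the same.\<close>

lemma eventually_weight_le_powr:
  assumes q: "0 < q" "q < 1" and \<beta>: "\<beta> > 1"
    and s: "s * ((1 + real N * q) * ln \<beta>) < bernoulli_entropy q"
    and lim: "(\<lambda>n. real (ones \<omega> n) / real n) \<longlonglongrightarrow> q"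
  shows "\<forall>\<^sub>F n in sequentially. weight q \<omega> n \<le> \<beta> powr (- s * real (block_start N \<omega> (Suc n)))"
proof -
  have "(\<lambda>n. ln (weight q \<omega> n) / real n + s * (real (block_start N \<omega> (Suc n)) / real n * ln \<beta>))
      \<longlonglongrightarrow> - bernoulli_entropy q + s * ((1 + real N * q) * ln \<beta>)"
    by (intro tendsto_intros ln_weight_ratio_tendsto block_start_ratio_tendsto q lim)
  from order_tendstoD(2)[OF this, of 0] s
  have "\<forall>\<^sub>F n in sequentially.
      ln (weight q \<omega> n) / real n + s * (real (block_start N \<omega> (Suc n)) / real n * ln \<beta>) < 0" by simp
  then show ?thesis using eventually_gt_at_top[of 0]
  proof eventually_elim
    case (elim n)
    then have "ln (weight q \<omega> n) + s * real (block_start N \<omega> (Suc n)) * ln \<beta> < 0"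
      by (simp add: field_simps)
    then have "exp (ln (weight q \<omega> n)) \<le> exp (- s * real (block_start N \<omega> (Suc n)) * ln \<beta>)" by simp
    then show ?case using \<beta> weight_pos[OF q] by (simp add: powr_def)
  qed
qed

section \<open>The upper bound\<close>

lemma dist_beta_le_powr:
  assumes "\<beta> > 1" "\<And>t. t < n \<Longrightarrow> x t = y t"
  shows "dist_beta \<beta> x y \<le> \<beta> powr (- real n)"
proof (cases "x = y")
  case False
  then have "\<exists>k. x k \<noteq> y k" by (simp only: fun_eq_iff not_all)
  then have "x (LEAST k. x k \<noteq> y k) \<noteq> y (LEAST k. x k \<noteq> y k)" by (rule LeastI_ex)
  then have "n \<le> (LEAST k. x k \<noteq> y k)"
    using assms(2) leI by blast
  then show ?thesis using assms(1) False by (simp add: dist_beta_def)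
qed (simp add: dist_beta_def)

lemma dist_beta_nonneg: "dist_beta \<beta> x y \<ge> 0"
  by (simp add: dist_beta_def)

lemma diam_pow_le:
  assumes "U \<noteq> {}" "s > 0" "\<And>x y. x \<in> U \<Longrightarrow> y \<in> U \<Longrightarrow> 0 \<le> d x y"
    and le: "\<And>x y. x \<in> U \<Longrightarrow> y \<in> U \<Longrightarrow> d x y \<le> r"
  shows "diam_pow d s U \<le> ennreal (r powr s)"
proof -
  have "diam_wrt d U \<le> r"
    unfolding diam_wrt_def using assms(1) le by (auto intro!: cSUP_least)
  moreover have "0 \<le> diam_wrt d U"
  proof -
    obtain x where x: "x \<in> U" using assms(1) by blast
    have "bdd_above ((\<lambda>(x, y). d x y) ` (U \<times> U))"
      using le by (intro bdd_aboveI2[of _ _ r]) auto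
    from cSUP_upper[OF _ this, of "(x, x)"] x
    have "d x x \<le> diam_wrt d U" by (auto simp: diam_wrt_def)
    then show ?thesis using assms(3)[OF x x] by linarith
  qed
  ultimately show ?thesis
    using assms(1,2) by (auto simp: diam_pow_def intro!: ennreal_leI powr_mono2)
qed

text \<open>Allows covers indexed by finite words instead of natural numbers, by reindexing along a
  bijection. A common bound on the finite sums of \<open>c\<close> takes the place of a convergence
  argument.\<close>

lemma hausdorff_premeasure_le_countable_cover:
  fixes V :: "'i::countable \<Rightarrow> 'a set" and c :: "'i \<Rightarrow> real"
  assumes inf: "infinite (UNIV :: 'i set)"
    and cover: "E \<subseteq> (\<Union>i. V i)" and sub: "\<And>i. V i \<subseteq> M"
    and diam: "\<And>i x y. x \<in> V i \<Longrightarrow> y \<in> V i \<Longrightarrow> d x y \<le> \<delta>"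
    and c: "\<And>i. diam_pow d s (V i) \<le> ennreal (c i)" "\<And>i. 0 \<le> c i"
    and fin: "\<And>F. finite F \<Longrightarrow> sum c F \<le> C"
  shows "hausdorff_premeasure M d s \<delta> E \<le> ennreal C"
proof -
  obtain e :: "nat \<Rightarrow> 'i" where e: "bij e"
    using bij_betw_from_nat_into[OF countableI_type inf] by blast
  have "(\<Union>n. V (e n)) = (\<Union>i. V i)"
    using bij_is_surj[OF e] by (metis image_image)
  then have "(\<lambda>n. V (e n)) \<in> delta_covers M d \<delta> E"
    using cover sub diam by (auto simp: delta_covers_def)
  then have "hausdorff_premeasure M d s \<delta> E \<le> (\<Sum>n. diam_pow d s (V (e n)))"
    unfolding hausdorff_premeasure_def by (rule INF_lower)
  also have "\<dots> \<le> (\<Sum>n. ennreal (c (e n)))"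
    by (intro suminf_le c summableI)
  also have "\<dots> \<le> ennreal C"
  proof (intro suminf_le_const summableI)
    fix n
    have "inj_on e {..<n}" using bij_is_inj[OF e] by (rule inj_on_subset) simp
    then have "(\<Sum>i<n. c (e i)) = sum c (e ` {..<n})"
      by (simp add: sum.reindex)
    also have "\<dots> \<le> C" by (rule fin) simp
    finally show "(\<Sum>i<n. ennreal (c (e i))) \<le> ennreal C"
      using c(2) by (simp add: sum_ennreal ennreal_leI)
  qed
  finally show ?thesis .
qed

text \<open>A word padded with \<open>False\<close>, so that \<open>weight\<close> and
  \<open>block_start\<close> apply to it; they are only evaluated at \<open>length l\<close>, where
  the padding is invisible.\<close>

definition prefix_seq :: "bool list \<Rightarrow> nat \<Rightarrow> bool" where
  "prefix_seq l i \<longleftrightarrow> i < length l \<and> l ! i"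

lemma weight_prefix_seq_Cons:
  "weight q (prefix_seq (b # l)) (Suc n) = (if b then q else 1 - q) * weight q (prefix_seq l) n"
  unfolding weight_def by (subst prod.lessThan_Suc_shift) (simp add: prefix_seq_def)

text \<open>Splitting off the first letter produces the factor \<open>q + (1 - q)\<close>, so the
  total stays \<open>1\<close> at every length.\<close>

lemma sum_weight_prefix_seq:
  "(\<Sum>l | length l = n. weight q (prefix_seq l) n) = 1"
proof (induction n)
  case (Suc n)
  let ?w = "\<lambda>b. if b then q else 1 - q"
  have "{l :: bool list. length l = Suc n} = (\<lambda>(b, l). b # l) ` (UNIV \<times> {l. length l = n})"
    by (auto simp: length_Suc_conv image_iff)
  moreover have "inj_on (\<lambda>(b, l). b # l) (UNIV \<times> {l :: bool list. length l = n})"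
    by (auto simp: inj_on_def)
  ultimately have "(\<Sum>l | length l = Suc n. weight q (prefix_seq l) (Suc n)) =
      (\<Sum>(b, l) \<in> UNIV \<times> {l. length l = n}. ?w b * weight q (prefix_seq l) n)"
    by (simp add: sum.reindex case_prod_unfold weight_prefix_seq_Cons)
  also have "\<dots> = (\<Sum>b\<in>UNIV. ?w b) * (\<Sum>l | length l = n. weight q (prefix_seq l) n)"
    by (simp add: sum_product sum.cartesian_product)
  finally show ?case by (simp add: Suc.IH UNIV_bool)
qed (simp add: weight_def)

lemma finite_lists_of_length: "finite {l :: bool list. length l = n}"
  using finite_lists_length_eq[of "UNIV :: bool set" n] by simp

text \<open>The covers consist of the images of the cylinders \<open>[l]\<close> with \<open>length l \<ge> m\<close> whose
  weight is at least \<open>\<beta> powr (- t * block_start)\<close> with \<open>t < s\<close>. The cylinders of a given length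
  have total weight at most \<open>1\<close>, and replacing \<open>t\<close> by \<open>s\<close> gains a geometric factor.\<close>

lemma hausdorff_measure_eq_0:
  assumes q: "0 < q" "q < 1" and \<beta>: "\<beta> > 1"
    and s: "bernoulli_entropy q < s * ((1 + real N * q) * ln \<beta>)" "s > 0"
    and E: "E \<subseteq> concat_blocks N ` {\<omega>. (\<lambda>n. real (ones \<omega> n) / real n) \<longlonglongrightarrow> q}"
  shows "hausdorff_measure binary_seqs (dist_beta \<beta>) s E = 0"
proof -
  define u where "u = (1 + real N * q) * ln \<beta>"
  have u: "u > 0" using q \<beta> unfolding u_def by (intro mult_pos_pos add_pos_nonneg) auto
  have "bernoulli_entropy q / u < s" using s u by (simp add: u_def pos_divide_less_eq)
  then obtain t where t: "bernoulli_entropy q / u < t" "t < s" using dense by blast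
  then have t_u: "bernoulli_entropy q < t * ((1 + real N * q) * ln \<beta>)"
    using u by (simp add: u_def pos_divide_less_eq)
  \<comment> \<open>For a block start \<open>b\<close>, \<open>\<beta> powr (- s * b)\<close> equals
    \<open>r ^ b\<close> times \<open>\<beta> powr (- t * b)\<close>.\<close>
  define r where "r = \<beta> powr (- (s - t))"
  have r: "0 < r" "r < 1" using t \<beta> by (auto simp: r_def powr_less_one)
  define good where "good l \<longleftrightarrow>
    \<beta> powr (- t * real (block_start N (prefix_seq l) (length l))) \<le> weight q (prefix_seq l) (length l)" for l
  define cyl where "cyl l = {\<omega> :: nat \<Rightarrow> bool. \<forall>i<length l. \<omega> i = l ! i}" for l
  have cyl: "\<omega> i = prefix_seq l i" if "\<omega> \<in> cyl l" "i < length l" for \<omega> l i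
    using that by (simp add: cyl_def prefix_seq_def)
  have premeasure_le: "hausdorff_premeasure binary_seqs (dist_beta \<beta>) s \<delta> E \<le> ennreal (r ^ m / (1 - r))"
    if m: "\<beta> powr (- real m) \<le> \<delta>" for \<delta> m
  proof (rule hausdorff_premeasure_le_countable_cover)
    \<comment> \<open>Short words and words that are not good receive the empty set, which
      contributes nothing, so all of \<open>bool list\<close> can serve as the index type.
      \<open>c\<close> still charges every long word, good or not, which makes its sums
      explicit.\<close>
    define V where "V l = (if m \<le> length l \<and> good l then concat_blocks N ` cyl l else {})" for l
    define c where "c l = (if m \<le> length l then r ^ length l * weight q (prefix_seq l) (length l) else 0)" for l
    have dist: "dist_beta \<beta> x y \<le> \<beta> powr (- real (block_start N (prefix_seq l) (length l)))"
      if xy: "x \<in> V l" "y \<in> V l" for x y l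
    proof -
      obtain \<omega> \<omega>' where \<omega>: "\<omega> \<in> cyl l" "\<omega>' \<in> cyl l" "x = concat_blocks N \<omega>" "y = concat_blocks N \<omega>'"
        using xy by (auto simp: V_def split: if_splits)
      have start: "block_start N \<omega> (length l) = block_start N (prefix_seq l) (length l)"
        using cyl[OF \<omega>(1)] by (rule block_start_cong)
      show ?thesis
        unfolding \<omega>(3,4)
      proof (rule dist_beta_le_powr[OF \<beta>])
        fix i assume "i < block_start N (prefix_seq l) (length l)"
        then show "concat_blocks N \<omega> i = concat_blocks N \<omega>' i"
          using cyl[OF \<omega>(1)] cyl[OF \<omega>(2)] start
          by (intro concat_blocks_cong[of "length l"]) auto
      qed
    qed
    show "infinite (UNIV :: bool list set)" by (rule infinite_UNIV_listI)
    show "E \<subseteq> (\<Union>l. V l)"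
    proof
      fix x assume "x \<in> E"
      then obtain \<omega> where x: "x = concat_blocks N \<omega>" and "(\<lambda>n. real (ones \<omega> n) / real n) \<longlonglongrightarrow> q"
        using E by blast
      \<comment> \<open>A sequence of frequency \<open>q\<close> has good prefixes of every
        sufficiently large length, hence one of length at least \<open>m\<close>.\<close>
      from eventually_conj[OF eventually_powr_le_weight[OF q \<beta> t_u this(2)] eventually_ge_at_top[of m]]
      obtain n where n: "\<beta> powr (- t * real (block_start N \<omega> n)) \<le> weight q \<omega> n" "m \<le> n"
        by (auto dest: eventually_happens)
      define l where "l = map \<omega> [0..<n]"
      have [simp]: "length l = n" by (simp add: l_def)
      have "\<omega> \<in> cyl l" by (simp add: cyl_def l_def)
      have eq: "prefix_seq l i = \<omega> i" if "i < n" for i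
        using cyl[OF \<open>\<omega> \<in> cyl l\<close>, of i] that by simp
      have "good l"
        using n(1) block_start_cong[of n "prefix_seq l" \<omega> N] eq by (simp add: good_def weight_def)
      then have "x \<in> V l" using n(2) \<open>\<omega> \<in> cyl l\<close> by (simp add: V_def x)
      then show "x \<in> (\<Union>l. V l)" by blast
    qed
    show "V l \<subseteq> binary_seqs" for l
      using concat_blocks_in_gap_seqs[of N] by (auto simp: V_def gap_seqs_def)
    show "dist_beta \<beta> x y \<le> \<delta>" if "x \<in> V l" "y \<in> V l" for l x y
    proof -
      have "m \<le> length l" using that by (auto simp: V_def split: if_splits)
      then have "m \<le> block_start N (prefix_seq l) (length l)"
        using le_block_start[of "length l" N "prefix_seq l"] by linarith
      then have "\<beta> powr (- real (block_start N (prefix_seq l) (length l))) \<le> \<beta> powr (- real m)"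
        using \<beta> by simp
      then show ?thesis using dist[OF that] m by linarith
    qed
    show c_nonneg: "0 \<le> c l" for l
      using r weight_pos[OF q] by (simp add: c_def less_imp_le)
    show "diam_pow (dist_beta \<beta>) s (V l) \<le> ennreal (c l)" for l
    proof (cases "V l = {}")
      case False
      then have l: "m \<le> length l" "good l" by (auto simp: V_def split: if_splits)
      define b where "b = block_start N (prefix_seq l) (length l)"
      have "diam_pow (dist_beta \<beta>) s (V l) \<le> ennreal ((\<beta> powr (- real b)) powr s)"
        unfolding b_def by (intro diam_pow_le False s dist_beta_nonneg dist)
      also have "(\<beta> powr (- real b)) powr s = \<beta> powr (- (s - t) * real b) * \<beta> powr (- t * real b)"
        by (simp add: powr_powr algebra_simps flip: powr_add)
      also have "\<beta> powr (- (s - t) * real b) * \<beta> powr (- t * real b) \<le>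
          r ^ length l * weight q (prefix_seq l) (length l)"
      proof (intro mult_mono)
        have "\<beta> powr (- (s - t) * real b) = r powr real b"
          by (simp add: r_def powr_powr)
        also have "\<dots> = r ^ b" using r by (simp add: powr_realpow)
        also have "\<dots> \<le> r ^ length l"
          using r le_block_start[of "length l" N "prefix_seq l"] unfolding b_def
          by (intro power_decreasing) auto
        finally show "\<beta> powr (- (s - t) * real b) \<le> r ^ length l" .
        show "\<beta> powr (- t * real b) \<le> weight q (prefix_seq l) (length l)"
          using l(2) by (simp add: good_def b_def)
      qed (use r in auto)
      finally show ?thesis using l(1) by (simp add: c_def ennreal_leI)
    qed (simp add: diam_pow_def)
    show "sum c F \<le> r ^ m / (1 - r)" if "finite F" for F
    proof -
      define L where "L n = {l :: bool list. length l = n}" for n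
      \<comment> \<open>A finite set of words has bounded length. At each length the weights sum to
        \<open>1\<close>, which leaves a geometric sum starting at \<open>m\<close>.\<close>
      obtain K where K: "length l \<le> K" if "l \<in> F" for l
        using finite_nat_set_iff_bounded_le[of "length ` F"] \<open>finite F\<close> by auto
      have "sum c F \<le> sum c (\<Union>n\<le>K. L n)"
        using K c_nonneg by (intro sum_mono2) (auto simp: L_def finite_lists_of_length)
      also have "\<dots> = (\<Sum>n\<le>K. sum c (L n))"
        by (intro sum.UNION_disjoint) (auto simp: L_def finite_lists_of_length)
      also have "\<dots> = (\<Sum>n\<le>K. if m \<le> n then r ^ n else 0)"
      proof (intro sum.cong refl)
        fix n
        have "sum c (L n) = (\<Sum>l\<in>L n. if m \<le> n then r ^ n * weight q (prefix_seq l) n else 0)"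
          by (intro sum.cong) (auto simp: c_def L_def)
        also have "\<dots> = (if m \<le> n then r ^ n else 0)"
          using sum_weight_prefix_seq[of q n] by (simp add: L_def flip: sum_distrib_left)
        finally show "sum c (L n) = (if m \<le> n then r ^ n else 0)" .
      qed
      also have "\<dots> = (\<Sum>n\<in>{m..K}. r ^ n)"
        by (intro sum.mono_neutral_cong_right) auto
      also have "\<dots> \<le> r ^ m / (1 - r)"
        using r by (auto simp: sum_gp divide_right_mono)
      finally show ?thesis .
    qed
  qed
  \<comment> \<open>For fixed \<delta> the minimal length \<open>m\<close> may still grow, and the
    bound \<open>r ^ m / (1 - r)\<close> tends to \<open>0\<close>.\<close>
  have "hausdorff_premeasure binary_seqs (dist_beta \<beta>) s \<delta> E \<le> 0" if "\<delta> > 0" for \<delta>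
  proof (rule tendsto_lowerbound)
    have "(\<lambda>m. ennreal (r ^ m / (1 - r))) \<longlonglongrightarrow> ennreal (0 / (1 - r))"
      using r by (intro tendsto_intros LIMSEQ_power_zero) auto
    then show "(\<lambda>m. ennreal (r ^ m / (1 - r))) \<longlonglongrightarrow> 0" by simp
    have "(\<lambda>m. \<beta> powr (- real m)) \<longlonglongrightarrow> 0"
      using \<beta> by real_asymp
    from order_tendstoD(2)[OF this \<open>\<delta> > 0\<close>]
    show "\<forall>\<^sub>F m in sequentially.
        hausdorff_premeasure binary_seqs (dist_beta \<beta>) s \<delta> E \<le> ennreal (r ^ m / (1 - r))"
      by eventually_elim (rule premeasure_le, simp)
  qed simp
  then show ?thesis unfolding hausdorff_measure_def by (intro antisym SUP_least) auto
qed

section \<open>The lower bound\<close>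

definition bernoulli_measure :: "real \<Rightarrow> (nat \<Rightarrow> bool) measure" where
  "bernoulli_measure q = PiM UNIV (\<lambda>_. measure_pmf (bernoulli_pmf q))"

lemma product_prob_space_bernoulli: "product_prob_space (\<lambda>_. measure_pmf (bernoulli_pmf q))"
  by (intro product_prob_spaceI) (simp add: measure_pmf.prob_space_axioms)

lemma prob_space_bernoulli_measure: "prob_space (bernoulli_measure q)"
  unfolding bernoulli_measure_def by (intro prob_space_PiM measure_pmf.prob_space_axioms)

lemma space_bernoulli_measure [simp]: "space (bernoulli_measure q) = UNIV"
  by (simp add: bernoulli_measure_def space_PiM)

lemma coin_measurable: "(\<lambda>\<omega>. \<omega> i) \<in> bernoulli_measure q \<rightarrow>\<^sub>M measure_pmf (bernoulli_pmf q)"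
  unfolding bernoulli_measure_def by (rule measurable_component_singleton) simp

lemma coin_pred_measurable [measurable]: "Measurable.pred (bernoulli_measure q) (\<lambda>\<omega>. \<omega> i)"
proof -
  have "(\<lambda>b. b) \<in> measure_pmf (bernoulli_pmf q) \<rightarrow>\<^sub>M count_space UNIV" by simp
  from measurable_compose[OF coin_measurable this] show ?thesis .
qed

lemma ones_measurable [measurable]: "(\<lambda>\<omega>. real (ones \<omega> n)) \<in> borel_measurable (bernoulli_measure q)"
proof -
  have "(\<lambda>\<omega>. real (ones \<omega> n)) = (\<lambda>\<omega>. \<Sum>i<n. if \<omega> i then 1 else 0)"
    by (auto simp: ones_def of_bool_def intro!: sum.cong)
  then show ?thesis by simp
qed

lemma indep_coins:
  "prob_space.indep_vars (bernoulli_measure q) (\<lambda>_. measure_pmf (bernoulli_pmf q)) (\<lambda>i \<omega>. \<omega> i) {..<n}"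
\<comment> \<open>Independence is characterised below by the joint distribution being a product, a
  criterion for nonempty index sets.\<close>
proof (cases "n = 0")
  case True
  then show ?thesis
    using prob_space_bernoulli_measure coin_measurable
    by (auto simp: prob_space.indep_vars_def prob_space.indep_sets_def)
next
  case False
  interpret P: product_prob_space "\<lambda>_. measure_pmf (bernoulli_pmf q)" UNIV
    by (rule product_prob_space_bernoulli)
  show ?thesis
  proof (subst prob_space.indep_vars_iff_distr_eq_PiM'[OF prob_space_bernoulli_measure])
    show "distr (bernoulli_measure q) (\<Pi>\<^sub>M i\<in>{..<n}. measure_pmf (bernoulli_pmf q)) (\<lambda>\<omega>. \<lambda>i\<in>{..<n}. \<omega> i) =
        (\<Pi>\<^sub>M i\<in>{..<n}. distr (bernoulli_measure q) (measure_pmf (bernoulli_pmf q)) (\<lambda>\<omega>. \<omega> i))"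
      using P.distr_PiM_restrict_finite[of "{..<n}"]
      by (simp add: bernoulli_measure_def P.PiM_component cong: PiM_cong)
  qed (use False coin_measurable in auto)
qed

lemma expectation_coin:
  assumes "0 \<le> q" "q \<le> 1"
  shows "(\<integral>\<omega>. (if \<omega> i then 1 else 0 :: real) \<partial>bernoulli_measure q) = q"
proof -
  interpret P: product_prob_space "\<lambda>_. measure_pmf (bernoulli_pmf q)" UNIV
    by (rule product_prob_space_bernoulli)
  have "(\<integral>\<omega>. (if \<omega> i then 1 else 0 :: real) \<partial>bernoulli_measure q) =
      (\<integral>b. (if b then 1 else 0) \<partial>distr (bernoulli_measure q) (measure_pmf (bernoulli_pmf q)) (\<lambda>\<omega>. \<omega> i))"
    by (rule integral_distr[symmetric, OF coin_measurable]) simp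
  also have "distr (bernoulli_measure q) (measure_pmf (bernoulli_pmf q)) (\<lambda>\<omega>. \<omega> i) = measure_pmf (bernoulli_pmf q)"
    unfolding bernoulli_measure_def by (rule P.PiM_component) simp
  also have "(\<integral>b. (if b then 1 else 0 :: real) \<partial>measure_pmf (bernoulli_pmf q)) = q"
    using assms by simp
  finally show ?thesis .
qed

text \<open>Hoeffding's inequality for independent variables with values in \<open>[0, 1]\<close>.
  The bound is written as an \<open>n\<close>-th power so that its summability is that of a
  geometric series.\<close>

lemma prob_ones_deviation_le:
  assumes q: "0 \<le> q" "q \<le> 1" and "\<epsilon> \<ge> 0" "n > 0"
  shows "measure (bernoulli_measure q) {\<omega>. \<bar>real (ones \<omega> n) - real n * q\<bar> \<ge> \<epsilon> * real n}
    \<le> 2 * exp (-2 * \<epsilon>\<^sup>2) ^ n"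
proof -
  define X where "X = (\<lambda>(i :: nat) (\<omega> :: nat \<Rightarrow> bool). if \<omega> i then 1 else 0 :: real)"
  interpret prob_space "bernoulli_measure q" by (rule prob_space_bernoulli_measure)
  interpret P: product_prob_space "\<lambda>_. measure_pmf (bernoulli_pmf q)" UNIV
    by (rule product_prob_space_bernoulli)
  interpret H: Hoeffding_ineq_iid "bernoulli_measure q" "{..<n}" X "X 0" 0 1 q
  proof unfold_locales
    show "indep_vars (\<lambda>_. borel) X {..<n}"
      unfolding X_def by (rule indep_vars_compose2[OF indep_coins]) simp
    have distr: "distr (bernoulli_measure q) borel (X i) =
        distr (measure_pmf (bernoulli_pmf q)) borel (\<lambda>b. if b then 1 else 0)" for i
    proof -
      have "distr (bernoulli_measure q) borel (X i) =
          distr (distr (bernoulli_measure q) (measure_pmf (bernoulli_pmf q)) (\<lambda>\<omega>. \<omega> i)) borel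
            (\<lambda>b. if b then 1 else 0)"
        by (subst distr_distr) (simp_all add: coin_measurable comp_def X_def)
      then show ?thesis
        using P.PiM_component[of i] by (simp add: bernoulli_measure_def)
    qed
    show "distr (bernoulli_measure q) borel (X i) = distr (bernoulli_measure q) borel (X 0)" for i
      by (simp only: distr)
    have "expectation (X 0) = q"
      using expectation_coin[OF q, of 0] by (simp add: X_def)
    then show "q \<equiv> expectation (X 0)" by simp
    show "random_variable borel (X 0)" unfolding X_def by measurable
  qed (auto simp: X_def)
  have "(\<Sum>i<n. X i \<omega>) = real (ones \<omega> n)" for \<omega>
    by (auto simp: ones_def X_def of_bool_def intro!: sum.cong)
  moreover have "-2 * (\<epsilon> * real n)\<^sup>2 / real n = real n * (-2 * \<epsilon>\<^sup>2)"
    using \<open>n > 0\<close> by (simp add: power2_eq_square)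
  moreover have "exp (-2 * \<epsilon>\<^sup>2) ^ n = exp (real n * (-2 * \<epsilon>\<^sup>2))"
    by (simp only: exp_of_nat_mult)
  moreover have "{..<n} \<noteq> {}" using \<open>n > 0\<close> by (simp add: lessThan_empty_iff)
  ultimately show ?thesis
    using H.Hoeffding_ineq_abs_ge[of "\<epsilon> * real n"] assms by simp
qed

text \<open>By Borel-Cantelli, for each tolerance \<open>1 / (k + 1)\<close> almost surely only
  finitely many deviations occur; the countably many exceptional null sets are then
  combined.\<close>

lemma AE_ones_ratio_tendsto:
  assumes q: "0 \<le> q" "q \<le> 1"
  shows "AE \<omega> in bernoulli_measure q. (\<lambda>n. real (ones \<omega> n) / real n) \<longlonglongrightarrow> q"
proof -
  interpret prob_space "bernoulli_measure q" by (rule prob_space_bernoulli_measure)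
  have "AE \<omega> in bernoulli_measure q. \<forall>\<^sub>F n in sequentially.
      \<bar>real (ones \<omega> n) - real n * q\<bar> < 1 / real (Suc k) * real n" for k
  proof -
    define \<epsilon> where "\<epsilon> = 1 / real (Suc k)"
    \<comment> \<open>The index is shifted by one because the deviation estimate requires a positive
      number of coins.\<close>
    define A where "A n = {\<omega>. \<bar>real (ones \<omega> (Suc n)) - real (Suc n) * q\<bar> \<ge> \<epsilon> * real (Suc n)}" for n
    have "\<epsilon> > 0" by (simp add: \<epsilon>_def)
    have "A n = {\<omega>\<in>space (bernoulli_measure q). \<bar>real (ones \<omega> (Suc n)) - real (Suc n) * q\<bar> \<ge> \<epsilon> * real (Suc n)}" for n
      by (simp add: A_def)
    then have A [measurable]: "A n \<in> sets (bernoulli_measure q)" for n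
      by (simp del: of_nat_Suc space_bernoulli_measure)
    have "AE \<omega> in bernoulli_measure q. \<forall>\<^sub>F n in sequentially. \<omega> \<in> space (bernoulli_measure q) - A n"
    proof (rule borel_cantelli_AE1)
      have "summable (\<lambda>n. 2 * exp (-2 * \<epsilon>\<^sup>2) ^ Suc n)"
        using \<open>\<epsilon> > 0\<close> by (intro summable_mult) (simp add: summable_Suc_iff summable_geometric)
      then show "summable (\<lambda>n. measure (bernoulli_measure q) (A n))"
      proof (rule summable_comparison_test')
        fix n
        show "norm (prob (A n)) \<le> 2 * exp (-2 * \<epsilon>\<^sup>2) ^ Suc n"
          using prob_ones_deviation_le[OF q, of \<epsilon> "Suc n"] \<open>\<epsilon> > 0\<close> unfolding A_def by simp
      qed
    qed (auto simp: less_top[symmetric])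
    then show ?thesis
    proof eventually_elim
      case (elim \<omega>)
      then have "\<forall>\<^sub>F n in sequentially. \<bar>real (ones \<omega> (Suc n)) - real (Suc n) * q\<bar> < \<epsilon> * real (Suc n)"
        by (simp add: A_def not_le del: of_nat_Suc)
      then show ?case unfolding \<epsilon>_def
        by (subst eventually_sequentially_Suc[symmetric])
    qed
  qed
  then have "AE \<omega> in bernoulli_measure q. \<forall>k. \<forall>\<^sub>F n in sequentially.
      \<bar>real (ones \<omega> n) - real n * q\<bar> < 1 / real (Suc k) * real n"
    by (simp only: AE_all_countable) simp
  then show ?thesis
  proof eventually_elim
    case (elim \<omega>)
    show ?case
    proof (rule tendstoI)
      fix e :: real assume "e > 0"
      then obtain k where k: "1 / real (Suc k) < e" using nat_approx_posE by blast
      from elim[rule_format, of k] eventually_gt_at_top[of 0]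
      show "\<forall>\<^sub>F n in sequentially. dist (real (ones \<omega> n) / real n) q < e"
      proof eventually_elim
        case (elim n)
        have "dist (real (ones \<omega> n) / real n) q = \<bar>real (ones \<omega> n) - real n * q\<bar> / real n"
        proof -
          have "real (ones \<omega> n) / real n - q = (real (ones \<omega> n) - real n * q) / real n"
            using elim(2) by (simp add: field_simps)
          then show ?thesis by (simp only: dist_real_def abs_divide abs_of_nat)
        qed
        also have "\<dots> < 1 / real (Suc k)"
          using elim by (simp add: pos_divide_less_eq del: of_nat_Suc)
        finally show ?case using k by linarith
      qed
    qed
  qed
qed

section \<open>Measures of cylinders against diameters of covering sets\<close>

lemma emeasure_cylinder:
  assumes q: "0 \<le> q" "q \<le> 1"
  shows "emeasure (bernoulli_measure q) {\<omega>'. \<forall>i<n. \<omega>' i = \<omega> i} = ennreal (weight q \<omega> n)"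
proof -
  interpret P: product_prob_space "\<lambda>_. measure_pmf (bernoulli_pmf q)" UNIV
    by (rule product_prob_space_bernoulli)
  have "emeasure (bernoulli_measure q) {\<omega>'. \<forall>i<n. \<omega>' i = \<omega> i} =
      (\<Prod>i<n. emeasure (measure_pmf (bernoulli_pmf q)) {\<omega> i})"
    using P.emeasure_PiM_Collect[of "{..<n}" "\<lambda>i. {\<omega> i}"]
    by (simp add: bernoulli_measure_def space_PiM Ball_def)
  also have "\<dots> = (\<Prod>i<n. ennreal (if \<omega> i then q else 1 - q))"
    using q by (intro prod.cong refl) (simp add: emeasure_pmf_single)
  also have "\<dots> = ennreal (weight q \<omega> n)"
    unfolding weight_def using q by (intro prod_ennreal) auto
  finally show ?thesis .
qed

text \<open>Needed for covering sets that are single points: for \<open>s > 0\<close> they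
  contribute \<open>0\<close>, so the measure must not charge them. The shrinking cylinders around
  \<omega> have weights tending to \<open>0\<close>.\<close>

lemma emeasure_singleton_eq_0:
  assumes q: "0 < q" "q < 1" and \<beta>: "\<beta> > 1" and "s > 0"
    and le: "\<And>n. m \<le> n \<Longrightarrow> weight q \<omega> n \<le> \<beta> powr (- s * real (block_start N \<omega> (Suc n)))"
  shows "emeasure (bernoulli_measure q) {\<omega>} = 0"
proof -
  interpret prob_space "bernoulli_measure q" by (rule prob_space_bernoulli_measure)
  have cyl: "{\<omega>'. \<forall>i<n. \<omega>' i = \<omega> i} \<in> events" for n
  proof -
    have "{\<omega>' \<in> space (bernoulli_measure q). \<forall>i<n. \<omega>' i = \<omega> i} \<in> events"
      by measurable
    then show ?thesis by simp
  qed
  have "emeasure (bernoulli_measure q) {\<omega>} \<le> 0"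
  proof (rule tendsto_lowerbound)
    have "(\<lambda>n. \<beta> powr (- s * real n)) \<longlonglongrightarrow> 0"
      using \<beta> \<open>s > 0\<close> by real_asymp
    then have "(\<lambda>n. ennreal (\<beta> powr (- s * real n))) \<longlonglongrightarrow> ennreal 0"
      by (rule tendsto_ennrealI)
    then show "(\<lambda>n. ennreal (\<beta> powr (- s * real n))) \<longlonglongrightarrow> 0" by simp
    show "\<forall>\<^sub>F n in sequentially. emeasure (bernoulli_measure q) {\<omega>} \<le> ennreal (\<beta> powr (- s * real n))"
      using eventually_ge_at_top[of m]
    proof eventually_elim
      case (elim n)
      have "emeasure (bernoulli_measure q) {\<omega>} \<le> emeasure (bernoulli_measure q) {\<omega>'. \<forall>i<n. \<omega>' i = \<omega> i}"
        by (rule emeasure_mono[OF _ cyl]) simp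
      also have "\<dots> = ennreal (weight q \<omega> n)" using q by (intro emeasure_cylinder) auto
      also have "\<dots> \<le> ennreal (\<beta> powr (- s * real (block_start N \<omega> (Suc n))))"
        by (rule ennreal_leI[OF le[OF elim]])
      also have "\<dots> \<le> ennreal (\<beta> powr (- s * real n))"
        using \<beta> \<open>s > 0\<close> le_block_start[of "Suc n" N \<omega>] by (intro ennreal_leI powr_mono) auto
      finally show ?case .
    qed
  qed simp
  then show ?thesis by simp
qed

text \<open>The set \<open>U\<close> lies in a beta-cylinder of the same diameter, given by the entries of
  \<open>concat_blocks N \<omega>\<close> before the first index \<open>k\<close> at which some element of \<open>U\<close> differs from it;
  \<open>j\<close> counts the blocks completed before \<open>k\<close>.\<close>

lemma preimage_subset_cylinder:
  assumes \<beta>: "\<beta> > 1" and x: "concat_blocks N \<omega> \<in> U" and ne: "U \<noteq> {concat_blocks N \<omega>}"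
    and diam: "\<And>x y. x \<in> U \<Longrightarrow> y \<in> U \<Longrightarrow> dist_beta \<beta> x y \<le> \<beta> powr (- real (Suc N * Suc m))"
  obtains j where "m \<le> j" "{\<omega>'. concat_blocks N \<omega>' \<in> U} \<subseteq> {\<omega>'. \<forall>i<j. \<omega>' i = \<omega> i}"
    "\<beta> powr (- real (block_start N \<omega> (Suc j))) \<le> diam_wrt (dist_beta \<beta>) U"
proof -
  define x where "x = concat_blocks N \<omega>"
  define k where "k = (LEAST k. \<exists>y\<in>U. x k \<noteq> y k)"
  obtain y where "y \<in> U" "y \<noteq> x" using x ne unfolding x_def by blast
  then have "\<exists>k. \<exists>y\<in>U. x k \<noteq> y k" by (metis ext)
  then have "\<exists>y\<in>U. x k \<noteq> y k" unfolding k_def by (rule LeastI_ex)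
  then obtain y where y: "y \<in> U" "x k \<noteq> y k" by blast
  have agree: "x t = y t" if "y \<in> U" "t < k" for y t
    using not_less_Least[of t "\<lambda>k. \<exists>y\<in>U. x k \<noteq> y k"] that unfolding k_def by blast
  have "(LEAST t. x t \<noteq> y t) = k"
    by (rule Least_equality[where P = "\<lambda>t. x t \<noteq> y t"]) (use y agree[OF y(1)] leI in blast)+
  moreover have "x \<noteq> y" using y(2) by auto
  ultimately have dist: "dist_beta \<beta> x y = \<beta> powr (- real k)" by (simp add: dist_beta_def)
  also have "\<dots> \<le> \<beta> powr (- real (Suc N * Suc m))"
    using diam[OF _ y(1), of x] x dist by (simp add: x_def)
  finally have k: "Suc N * Suc m \<le> k"
    using \<beta> by (simp only: dist powr_le_cancel_iff neg_le_iff_le of_nat_le_iff)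
  obtain j where j: "block_start N \<omega> j \<le> k" "k < block_start N \<omega> (Suc j)" by (rule block_containing)
  \<comment> \<open>A block has length at most \<open>N + 1\<close>, so reaching position
    \<open>(N + 1) * (m + 1)\<close> requires more than \<open>m\<close> completed blocks. This is
    the origin of the exponent in the diameter bound.\<close>
  have "block_start N \<omega> (Suc j) \<le> Suc N * Suc j"
    using mult_le_mono2[OF ones_le[of \<omega> "Suc j"], of N] by (simp add: block_start_def)
  with j k have "Suc N * Suc m < Suc N * Suc j" by linarith
  then have "m < j" by (simp only: Suc_mult_less_cancel1 Suc_less_eq)
  show thesis
  proof (rule that[of j])
    show "m \<le> j" using \<open>m < j\<close> by simp
    show "{\<omega>'. concat_blocks N \<omega>' \<in> U} \<subseteq> {\<omega>'. \<forall>i<j. \<omega>' i = \<omega> i}"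
    proof (intro subsetI CollectI allI impI)
      fix \<omega>' i assume "\<omega>' \<in> {\<omega>'. concat_blocks N \<omega>' \<in> U}" "i < j"
      then have "concat_blocks N \<omega>' \<in> U" "i < j" by simp_all
      then have "\<omega> i = \<omega>' i"
        using agree j(1) unfolding x_def by (intro concat_blocks_eq_imp_eq[of k N \<omega> \<omega>' j i])
      then show "\<omega>' i = \<omega> i" by (rule sym)
    qed
    have "\<beta> powr (- real (block_start N \<omega> (Suc j))) \<le> \<beta> powr (- real k)"
      using \<beta> j(2) by simp
    also have "\<dots> = dist_beta \<beta> x y" by (simp only: dist)
    also have "\<dots> \<le> diam_wrt (dist_beta \<beta>) U"
    proof -
      have "bdd_above ((\<lambda>(x, y). dist_beta \<beta> x y) ` (U \<times> U))"
        using diam by (intro bdd_aboveI2) auto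
      from cSUP_upper[OF _ this, of "(x, y)"] x y(1) show ?thesis
        by (auto simp: diam_wrt_def x_def)
    qed
    finally show "\<beta> powr (- real (block_start N \<omega> (Suc j))) \<le> diam_wrt (dist_beta \<beta>) U" .
  qed
qed

text \<open>Mass distribution principle: on a set of positive measure the weights decay uniformly,
  so each covering set contributes at least the measure of the part of that set which it covers.
  Every fine cover then has total at least this fixed positive measure.\<close>

lemma hausdorff_measure_neq_0:
  assumes q: "0 < q" "q < 1" and \<beta>: "\<beta> > 1"
    and s: "s * ((1 + real N * q) * ln \<beta>) < bernoulli_entropy q" "s \<ge> 0"
    and E: "concat_blocks N ` {\<omega>. (\<lambda>n. real (ones \<omega> n) / real n) \<longlonglongrightarrow> q} \<subseteq> E"
  shows "hausdorff_measure binary_seqs (dist_beta \<beta>) s E \<noteq> 0"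
proof -
  interpret prob_space "bernoulli_measure q" by (rule prob_space_bernoulli_measure)
  let ?P = "emeasure (bernoulli_measure q)"
  have "AE \<omega> in bernoulli_measure q. (\<lambda>n. real (ones \<omega> n) / real n) \<longlonglongrightarrow> q"
    using q by (intro AE_ones_ratio_tendsto) auto
  then obtain Z where Z: "{\<omega>. \<not> (\<lambda>n. real (ones \<omega> n) / real n) \<longlonglongrightarrow> q} \<subseteq> Z" "?P Z = 0"
    and Z_events [measurable]: "Z \<in> events"
    by (auto elim!: AE_E)
  \<comment> \<open>An exhaustion in the manner of Egorov: on \<open>G m\<close> the decay holds
    uniformly from index \<open>m\<close> on. Removing the null set \<open>Z\<close> leaves only
    sequences of frequency \<open>q\<close>, which are coded into \<open>E\<close>.\<close>
  define G where "G m = {\<omega>. \<forall>n\<ge>m. weight q \<omega> n \<le> \<beta> powr (- s * real (block_start N \<omega> (Suc n)))} - Z" for m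
  have G_events: "G m \<in> events" for m
  proof -
    define f where "f n \<omega> = \<beta> powr (- s * real (block_start N \<omega> (Suc n))) - weight q \<omega> n" for n \<omega>
    have "(\<lambda>x. \<beta> powr (- s * (real (Suc n) + real N * x))) \<in> borel_measurable borel" for n
      by measurable
    from measurable_compose[OF ones_measurable this]
    have "(\<lambda>\<omega>. \<beta> powr (- s * real (block_start N \<omega> (Suc n)))) \<in> borel_measurable (bernoulli_measure q)" for n
      by (simp only: block_start_def of_nat_add of_nat_mult)
    moreover have "(\<lambda>\<omega>. weight q \<omega> n) \<in> borel_measurable (bernoulli_measure q)" for n
      unfolding weight_def by measurable
    ultimately have [measurable]: "f n \<in> borel_measurable (bernoulli_measure q)" for n
      unfolding f_def by (intro borel_measurable_diff)
    have "{\<omega> \<in> space (bernoulli_measure q). \<forall>n. m \<le> n \<longrightarrow> 0 \<le> f n \<omega>} \<in> events"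
      by measurable
    then show ?thesis unfolding G_def by (intro sets.Diff) (simp_all add: f_def)
  qed
  have lim: "(\<lambda>n. real (ones \<omega> n) / real n) \<longlonglongrightarrow> q" if "\<omega> \<notin> Z" for \<omega>
    using Z(1) that by blast
  have "(\<Union>m. G m) = UNIV - Z"
    using eventually_weight_le_powr[OF q \<beta> s(1) lim] by (auto simp: G_def eventually_sequentially)
  moreover have "?P (UNIV - Z) = ?P UNIV"
    using Z(2) Z_events sets.top[of "bernoulli_measure q"]
    by (intro emeasure_Diff_null_set null_setsI) auto
  ultimately have "?P (\<Union>m. G m) = 1"
    using emeasure_space_1 by simp
  then obtain m where m: "?P (G m) \<noteq> 0"
    using emeasure_UN_eq_0[of "bernoulli_measure q" G] G_events by auto
  \<comment> \<open>Small enough for \<open>preimage_subset_cylinder\<close> to yield a cylinder of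
    length at least \<open>m\<close>, where the decay on \<open>G m\<close> is available.\<close>
  define \<delta> where "\<delta> = \<beta> powr (- real (Suc N * Suc m))"
  have "?P (G m) \<le> (\<Sum>i. diam_pow (dist_beta \<beta>) s (U i))"
    if U: "U \<in> delta_covers binary_seqs (dist_beta \<beta>) \<delta> E" for U
  proof -
    \<comment> \<open>A covering set is arbitrary, so its preimage is enclosed in a measurable set
      \<open>C\<close> before measures are compared.\<close>
    have "\<exists>C\<in>events. {\<omega>\<in>G m. concat_blocks N \<omega> \<in> U i} \<subseteq> C \<and> ?P C \<le> diam_pow (dist_beta \<beta>) s (U i)" for i
    proof (cases "\<exists>\<omega>\<in>G m. concat_blocks N \<omega> \<in> U i")
      case False
      then show ?thesis by (intro bexI[of _ "{}"]) auto
    next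
      case True
      then obtain \<omega> where \<omega>: "\<omega> \<in> G m" "concat_blocks N \<omega> \<in> U i" by blast
      then have weight_le: "weight q \<omega> n \<le> \<beta> powr (- s * real (block_start N \<omega> (Suc n)))" if "m \<le> n" for n
        using that by (simp add: G_def)
      have diam: "dist_beta \<beta> x y \<le> \<delta>" if "x \<in> U i" "y \<in> U i" for x y
        using U that by (auto simp: delta_covers_def)
      \<comment> \<open>For \<open>s = 0\<close> a nonempty set contributes \<open>1\<close>, which
        bounds any probability; a single point contributes \<open>0\<close> and its preimage is
        null; only a set with at least two points needs the cylinder estimate.\<close>
      consider "s = 0" | "s > 0" "U i = {concat_blocks N \<omega>}" | "s > 0" "U i \<noteq> {concat_blocks N \<omega>}"
        using s(2) by linarith
      then show ?thesis
      proof cases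
        case 1
        then have "diam_pow (dist_beta \<beta>) s (U i) = 1" using \<omega>(2) by (auto simp: diam_pow_def)
        then show ?thesis
          using sets.top[of "bernoulli_measure q"] emeasure_space_1 by (intro bexI[of _ UNIV]) auto
      next
        case 2
        have "\<omega>' = \<omega>" if "concat_blocks N \<omega>' = concat_blocks N \<omega>" for \<omega>'
        proof
          fix n
          show "\<omega>' n = \<omega> n"
            by (rule concat_blocks_eq_imp_eq[of _ N \<omega>' \<omega>, OF _ order_refl lessI]) (simp only: that)
        qed
        then have "{\<omega>\<in>G m. concat_blocks N \<omega> \<in> U i} \<subseteq> {\<omega>}" using 2(2) by blast
        moreover have "?P {\<omega>} = 0"
          using weight_le by (rule emeasure_singleton_eq_0[OF q \<beta> 2(1)])
        moreover have "{\<omega>} \<in> events"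
        proof -
          have "{\<omega>' \<in> space (bernoulli_measure q). \<forall>i. \<omega>' i = \<omega> i} \<in> events" by measurable
          then show ?thesis by (simp flip: fun_eq_iff)
        qed
        ultimately show ?thesis by (intro bexI[of _ "{\<omega>}"]) auto
      next
        case 3
        obtain j where j: "m \<le> j" "{\<omega>'. concat_blocks N \<omega>' \<in> U i} \<subseteq> {\<omega>'. \<forall>i<j. \<omega>' i = \<omega> i}"
          "\<beta> powr (- real (block_start N \<omega> (Suc j))) \<le> diam_wrt (dist_beta \<beta>) (U i)"
          using preimage_subset_cylinder[OF \<beta> \<omega>(2) 3(2) diam[unfolded \<delta>_def]] by blast
        have "?P {\<omega>'. \<forall>i<j. \<omega>' i = \<omega> i} = ennreal (weight q \<omega> j)"
          using q by (intro emeasure_cylinder) auto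
        also have "\<dots> \<le> ennreal (\<beta> powr (- s * real (block_start N \<omega> (Suc j))))"
          by (rule ennreal_leI[OF weight_le[OF j(1)]])
        also have "\<beta> powr (- s * real (block_start N \<omega> (Suc j))) =
            (\<beta> powr (- real (block_start N \<omega> (Suc j)))) powr s"
          by (simp add: powr_powr mult.commute)
        also have "ennreal \<dots> \<le> ennreal (diam_wrt (dist_beta \<beta>) (U i) powr s)"
          using j(3) 3(1) by (intro ennreal_leI powr_mono2) auto
        also have "\<dots> = diam_pow (dist_beta \<beta>) s (U i)"
          using \<omega>(2) 3(1) by (auto simp: diam_pow_def)
        finally have "?P {\<omega>'. \<forall>i<j. \<omega>' i = \<omega> i} \<le> diam_pow (dist_beta \<beta>) s (U i)" .
        moreover have "{\<omega>'. \<forall>i<j. \<omega>' i = \<omega> i} \<in> events"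
        proof -
          have "{\<omega>' \<in> space (bernoulli_measure q). \<forall>i<j. \<omega>' i = \<omega> i} \<in> events" by measurable
          then show ?thesis by simp
        qed
        ultimately show ?thesis using j(2) by (intro bexI[of _ "{\<omega>'. \<forall>i<j. \<omega>' i = \<omega> i}"]) auto
      qed
    qed
    then have "\<exists>C. \<forall>i. C i \<in> events \<and> {\<omega>\<in>G m. concat_blocks N \<omega> \<in> U i} \<subseteq> C i \<and>
        ?P (C i) \<le> diam_pow (dist_beta \<beta>) s (U i)"
      unfolding Bex_def by (intro choice allI)
    then obtain C where C: "\<And>i. C i \<in> events" "\<And>i. {\<omega>\<in>G m. concat_blocks N \<omega> \<in> U i} \<subseteq> C i"
      "\<And>i. ?P (C i) \<le> diam_pow (dist_beta \<beta>) s (U i)"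
      by blast
    have "G m \<subseteq> (\<Union>i. C i)"
    proof
      fix \<omega> assume "\<omega> \<in> G m"
      then have "concat_blocks N \<omega> \<in> E" using lim[of \<omega>] E by (auto simp: G_def)
      then obtain i where "concat_blocks N \<omega> \<in> U i" using U by (auto simp: delta_covers_def)
      with C(2)[of i] \<open>\<omega> \<in> G m\<close> show "\<omega> \<in> (\<Union>i. C i)" by blast
    qed
    then have "?P (G m) \<le> ?P (\<Union>i. C i)"
      using C(1) by (intro emeasure_mono) auto
    also have "\<dots> \<le> (\<Sum>i. ?P (C i))"
      using C(1) by (intro emeasure_subadditive_countably) auto
    also have "\<dots> \<le> (\<Sum>i. diam_pow (dist_beta \<beta>) s (U i))"
      by (intro suminf_le C summableI)
    finally show ?thesis .
  qed
  then have "?P (G m) \<le> hausdorff_premeasure binary_seqs (dist_beta \<beta>) s \<delta> E"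
    unfolding hausdorff_premeasure_def by (rule INF_greatest)
  also have "\<dots> \<le> hausdorff_measure binary_seqs (dist_beta \<beta>) s E"
    unfolding hausdorff_measure_def using \<beta> by (intro SUP_upper) (simp add: \<delta>_def)
  finally show ?thesis using m by auto
qed

section \<open>The dimension formula\<close>

lemma bernoulli_entropy_pos: "0 < q \<Longrightarrow> q < 1 \<Longrightarrow> 0 < bernoulli_entropy q"
  unfolding bernoulli_entropy_def using mult_pos_neg[of q "ln q"] mult_pos_neg[of "1 - q" "ln (1 - q)"] by simp

text \<open>Every exponent above the quotient gives measure zero, hence the upper bound up to any
  \<open>e > 0\<close>; no nonnegative exponent below it does, so the quotient is a lower bound for
  the set whose infimum is taken.\<close>

lemma hausdorff_dim_concat_blocks:
  assumes q: "0 < q" "q < 1" and \<beta>: "\<beta> > 1"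
  shows "hausdorff_dim binary_seqs (dist_beta \<beta>)
      (concat_blocks N ` {\<omega>. (\<lambda>n. real (ones \<omega> n) / real n) \<longlonglongrightarrow> q}) =
    ereal (bernoulli_entropy q / ((1 + real N * q) * ln \<beta>))"
    (is "hausdorff_dim _ _ ?E = ereal ?D")
proof (rule antisym)
  have u: "(1 + real N * q) * ln \<beta> > 0" using q \<beta> by (intro mult_pos_pos add_pos_nonneg) auto
  have D: "?D > 0" using bernoulli_entropy_pos[OF q] u by (rule divide_pos_pos)
  show "hausdorff_dim binary_seqs (dist_beta \<beta>) ?E \<le> ereal ?D"
  proof (rule ereal_le_epsilon2)
    fix e :: real assume "e > 0"
    then have "?D < ?D + e" by simp
    then have "bernoulli_entropy q < (?D + e) * ((1 + real N * q) * ln \<beta>)"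
      by (simp only: pos_divide_less_eq[OF u])
    then have "hausdorff_measure binary_seqs (dist_beta \<beta>) (?D + e) ?E = 0"
      using D \<open>e > 0\<close> by (intro hausdorff_measure_eq_0[OF q \<beta>]) auto
    then show "hausdorff_dim binary_seqs (dist_beta \<beta>) ?E \<le> ereal ?D + ereal e"
      unfolding hausdorff_dim_def using D \<open>e > 0\<close> by (auto intro!: Inf_lower imageI)
  qed
  show "ereal ?D \<le> hausdorff_dim binary_seqs (dist_beta \<beta>) ?E"
    unfolding hausdorff_dim_def
  proof (rule Inf_greatest, clarify)
    fix s assume s: "0 \<le> s" "hausdorff_measure binary_seqs (dist_beta \<beta>) s ?E = 0"
    have "\<not> s * ((1 + real N * q) * ln \<beta>) < bernoulli_entropy q"
      using hausdorff_measure_neq_0[OF q \<beta> _ s(1) order_refl] s(2) by blast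
    then show "ereal ?D \<le> ereal s" using u by (simp add: pos_divide_le_eq not_less)
  qed
qed

lemma freq_set_eq_image:
  assumes "\<beta> > 1" "N \<ge> 1" "\<beta> ^ (N + 1) - \<beta> ^ N - 1 = 0" "0 \<le> \<alpha>" "real N * \<alpha> < 1"
  shows "freq_set \<beta> \<alpha> =
    concat_blocks N ` {\<omega>. (\<lambda>n. real (ones \<omega> n) / real n) \<longlonglongrightarrow> \<alpha> / (1 - real N * \<alpha>)}"
  unfolding freq_set_def beta_shift_eq_gap_seqs[OF assms(1-3)] gap_seqs_eq_range
  using frequency_concat_blocks_iff[OF assms(4,5)] by blast

text \<open>With \<open>a = 1 - N \<alpha>\<close> and \<open>r = 1 - (N + 1) \<alpha>\<close>, the
  block probabilities are \<open>\<alpha> / a\<close> and \<open>r / a\<close>, and the mean block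
  length is \<open>1 / a\<close>; dividing by it cancels the common denominator.\<close>

lemma bernoulli_entropy_block_probability:
  fixes \<alpha> :: real and N :: nat
  defines "q \<equiv> \<alpha> / (1 - real N * \<alpha>)"
  assumes \<alpha>: "0 < \<alpha>" "(real N + 1) * \<alpha> < 1"
  shows "bernoulli_entropy q / (1 + real N * q) =
    (1 - real N * \<alpha>) * ln ((1 - real N * \<alpha>) / (1 - (real N + 1) * \<alpha>))
      - \<alpha> * ln (\<alpha> / (1 - (real N + 1) * \<alpha>))"
proof -
  define a where "a = 1 - real N * \<alpha>"
  define r where "r = 1 - (real N + 1) * \<alpha>"
  have r: "r > 0" and a: "a = r + \<alpha>" using \<alpha> by (simp_all add: a_def r_def algebra_simps)
  then have "a > 0" using \<alpha> by simp
  have q: "q = \<alpha> / a" by (simp only: q_def a_def)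
  have "1 - q = (a - \<alpha>) / a" "1 + real N * q = (a + real N * \<alpha>) / a"
    using \<open>a > 0\<close> by (simp_all only: q) (simp_all add: field_simps)
  then have q': "1 - q = r / a" "1 + real N * q = 1 / a"
    by (simp_all only: a_def r_def) (simp_all add: algebra_simps)
  have "bernoulli_entropy q = - (\<alpha> / a) * ln (\<alpha> / a) - (r / a) * ln (r / a)"
    unfolding bernoulli_entropy_def q'(1) by (simp only: q)
  also have "\<dots> = (- \<alpha> * (ln \<alpha> - ln a) - r * (ln r - ln a)) / a"
    using \<open>a > 0\<close> r \<alpha>(1) by (simp add: ln_div diff_divide_distrib)
  finally have "bernoulli_entropy q / (1 + real N * q) = - \<alpha> * (ln \<alpha> - ln a) - r * (ln r - ln a)"
    unfolding q'(2) using \<open>a > 0\<close> by simp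
  \<comment> \<open>The relation \<open>a = r + \<alpha>\<close> merges the multiples of
    \<open>ln a\<close> here and redistributes \<open>ln r\<close> in the next step.\<close>
  also have "\<dots> = a * ln a - \<alpha> * ln \<alpha> - r * ln r"
    by (simp add: a algebra_simps)
  also have "\<dots> = a * ln (a / r) - \<alpha> * ln (\<alpha> / r)"
    using \<open>a > 0\<close> r \<alpha> by (simp add: ln_div a algebra_simps)
  finally show ?thesis by (simp only: a_def r_def)
qed

theorem theorem7p1:
  fixes \<beta> \<alpha> :: real and N :: nat
  assumes "\<beta> > 1"
    and "N \<ge> 1"
    and "\<beta> ^ (N + 1) - \<beta> ^ N - 1 = 0"
    and "0 < \<alpha>" and "\<alpha> < 1 / (real N + 1)"
  shows "hausdorff_dim binary_seqs (dist_beta \<beta>) (freq_set \<beta> \<alpha>) =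
    ereal ((1 / ln \<beta>) *
      ((1 - real N * \<alpha>) * ln ((1 - real N * \<alpha>) / (1 - (real N + 1) * \<alpha>))
        - \<alpha> * ln (\<alpha> / (1 - (real N + 1) * \<alpha>))))"
proof -
  define q where "q = \<alpha> / (1 - real N * \<alpha>)"
  have \<alpha>: "(real N + 1) * \<alpha> < 1"
    using assms(5) by (simp add: pos_less_divide_eq mult.commute)
  then have N\<alpha>: "real N * \<alpha> < 1" using \<open>0 < \<alpha>\<close> by (simp add: algebra_simps)
  \<comment> \<open>The strict upper bound on \<alpha> is exactly what makes the probability of the
    long block less than \<open>1\<close>.\<close>
  have q: "0 < q" "q < 1"
    using \<alpha> N\<alpha> \<open>0 < \<alpha>\<close> by (simp_all add: q_def pos_divide_less_eq algebra_simps)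
  have "hausdorff_dim binary_seqs (dist_beta \<beta>) (freq_set \<beta> \<alpha>) =
      ereal (bernoulli_entropy q / ((1 + real N * q) * ln \<beta>))"
    using freq_set_eq_image[OF assms(1-3) less_imp_le[OF assms(4)] N\<alpha>]
      hausdorff_dim_concat_blocks[OF q assms(1), of N] by (simp only: q_def)
  also have "bernoulli_entropy q / ((1 + real N * q) * ln \<beta>) =
      (1 / ln \<beta>) * (bernoulli_entropy q / (1 + real N * q))"
    by simp
  finally show ?thesis
    by (simp only: q_def bernoulli_entropy_block_probability[OF assms(4) \<alpha>])
qed

end
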